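(* Let $X^*$ be a solution of $$\mathbf{A}(X)=y,\quad X\in\mathcal{M}_{k,s},$$ with exactly $s$ nonzero rows, and assume $\operatorname{rank}(X^* )=\min(k,s)$. Let $S^*\subseteq\{1,\dots,M\}$, $|S^*|=s$, be the row support of $X^*$. Assume the spectral norm of $\mathbf{I}-\mathbf{A}^*\mathbf{A}$ on the tangent space $T_{X^*}\mathcal{M}_{k,S^*}$ is $\delta<1$. Then there exists an $\epsilon>0$ such that if the sequence $(X_\ell)$ generated by the Riemannian iterative hard thresholding iteration $$X_{\ell+1}=(\mathbf{T}_k\circ\mathbf{H}_s)\bigl(X_\ell-\mathbf{P}_\ell(\mathbf{A}^*(\mathbf{A}(X_\ell)-y))\bigr),\qquad\ell=1,2,\dots,$$ with starting point $X_1=(\mathbf{T}_k\circ\mathbf{H}_s)(\alpha_0\mathbf{A}^*y)\in\mathcal{M}_{k,s}$, $\alpha_0\in\mathbb{R}$, satisfies $\|X_\ell-X^*\|_F\le\epsilon$ for some $\ell$, then $X_\ell$ converges to $X^*$ and $$\limsup_{\ell\to\infty}\frac{\|X_{\ell+1}-X^*\|_F}{\|X_\ell-X^*\|_F}\le\delta.$$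
   Context: $M,N,m,k,s$ are positive integers with $k<s$. $\mathbf{A}:\mathbb{R}^{M\times N}\to\mathbb{R}^m$ is a linear operator, $\mathbf{A}^*$ its adjoint with respect to the Frobenius and Euclidean inner products, $y\in\mathbb{R}^m$, and $\mathbf{I}$ is the identity on $\mathbb{R}^{M\times N}$. $\|X\|_0$ denotes the number of nonzero rows of $X$; $\mathcal{M}_k=\{X\in\mathbb{R}^{M\times N}:\operatorname{rank}(X)\le k\}$ and $\mathcal{M}_{k,s}=\{X\in\mathcal{M}_k:\|X\|_0\le s\}$. $\mathcal{M}_{k,S^*}$ denotes the variety of matrices in $\mathbb{R}^{M\times N}$ of rank at most $k$ whose nonzero rows all have indices in $S^*$; under the rank assumption on $X^*$ it is a smooth manifold around $X^*$, and $T_{X^*}\mathcal{M}_{k,S^*}$ is its tangent space at $X^*$. The spectral norm of $\mathbf{I}-\mathbf{A}^*\mathbf{A}$ on a linear subspace $T\subseteq\mathbb{R}^{M\times N}$ is the operator norm (with respect to the Frobenius norm) of $\mathbf{P}_T(\mathbf{I}-\mathbf{A}^*\mathbf{A})\mathbf{P}_T$, where $\mathbf{P}_T$ is the orthogonal projection onto $T$. $\mathbf{H}_s(X)=X_S$, where $S\subseteq\{1,\dots,M\}$ contains the indices of $s$ rows of $X$ with largest Euclidean norm, and $X_S$ denotes $X$ with all rows not in $S$ set to zero. $\mathbf{T}_k(X)$ is a best approximation of $X$ in Frobenius norm by matrices of rank at most $k$. If these are not unique, some specific (arbitrary) selection rule is applied. If $\operatorname{rank}(X_\ell)=k$ with (thin)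 singular value decomposition $X_\ell=U_\ell\Sigma_\ell V_\ell^\top$, then $\mathbf{P}_\ell$ is the orthogonal projection onto the tangent space of the manifold of rank-$k$ matrices at $X_\ell$, $$\mathbf{P}_\ell(Z)=U_\ell U_\ell^\top Z+ZV_\ell V_\ell^\top-U_\ell U_\ell^\top ZV_\ell V_\ell^\top.$$ If $\operatorname{rank}(X_\ell)<k$, $\mathbf{P}_\ell$ denotes instead a metric projection onto the tangent cone of $\mathcal{M}_k$ at $X_\ell$. In the quotient, $0/0$ is read as $0$. *)

theory Defs
  imports "HOL-Analysis.Analysis"
begin

text \<open>
  Real \<open>M \<times> N\<close> matrices are elements of \<open>real^'N^'M\<close>, so that \<open>X $ i\<close> is the \<open>i\<close>-th row.
  The library's \<open>norm\<close> and \<open>inner\<close> on this type are the Frobenius norm and inner product.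
\<close>

definition row_support :: "real^'N^'M \<Rightarrow> 'M set"
  where "row_support X = {i. X $ i \<noteq> 0}"

definition restrict_rows :: "'M set \<Rightarrow> real^'N^'M \<Rightarrow> real^'N^'M"
  where "restrict_rows S X = (\<chi> i. if i \<in> S then X $ i else 0)"

definition rank_le :: "nat \<Rightarrow> (real^'N^'M) set"
  where "rank_le k = {X. rank X \<le> k}"

definition rank_row_sparse :: "nat \<Rightarrow> nat \<Rightarrow> (real^'N^'M) set"
  where "rank_row_sparse k s = {X \<in> rank_le k. card (row_support X) \<le> s}"

definition rank_le_rows_in :: "nat \<Rightarrow> 'M set \<Rightarrow> (real^'N^'M) set"
  where "rank_le_rows_in k S = {X \<in> rank_le k. row_support X \<subseteq> S}"


text \<open>
  Velocities at \<open>x\<close> of \<open>C\<^sup>1\<close> curves in \<open>S\<close>. To be used only where \<open>S\<close> is, near \<open>x\<close>,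
  an embedded submanifold; there it is the tangent space, in particular a linear subspace.
\<close>

definition tangent_space :: "'a::real_normed_vector set \<Rightarrow> 'a \<Rightarrow> 'a set"
  where "tangent_space S x =
    {v. \<exists>e>0. \<exists>c :: real \<Rightarrow> 'a.
          c 0 = x \<and> c ` {-e<..<e} \<subseteq> S \<and> c C1_differentiable_on {-e<..<e} \<and>
          (c has_vector_derivative v) (at 0)}"

text \<open>The Bouligand (contingent) cone.\<close>

definition tangent_cone :: "'a::real_normed_vector set \<Rightarrow> 'a \<Rightarrow> 'a set"
  where "tangent_cone S x =
    {v. \<exists>(Y :: nat \<Rightarrow> 'a) (a :: nat \<Rightarrow> real).
          (\<forall>n. Y n \<in> S \<and> a n > 0) \<and> Y \<longlonglongrightarrow> x \<and> (\<lambda>n. a n *\<^sub>R (Y n - x)) \<longlonglongrightarrow> v}"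

text \<open>Uniquely determined when \<open>T\<close> is a linear subspace of a Euclidean space.\<close>

definition orth_proj :: "'a::real_inner set \<Rightarrow> 'a \<Rightarrow> 'a"
  where "orth_proj T x = (THE p. p \<in> T \<and> (\<forall>v\<in>T. orthogonal (x - p) v))"

definition spectral_norm_on :: "'a::real_inner set \<Rightarrow> ('a \<Rightarrow> 'a) \<Rightarrow> real"
  where "spectral_norm_on T f = onorm (orth_proj T \<circ> f \<circ> orth_proj T)"


text \<open>
  Metric projections and hard thresholding are not single-valued, so they are given as
  relations between an argument and an admissible value. A selection rule is then any
  function whose graph is contained in the relation.
\<close>

definition is_metric_proj :: "'a::metric_space set \<Rightarrow> 'a \<Rightarrow> 'a \<Rightarrow> bool"
  where "is_metric_proj S x p \<longleftrightarrow> p \<in> S \<and> (\<forall>q\<in>S. dist x p \<le> dist x q)"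

definition is_row_threshold :: "nat \<Rightarrow> real^'N^'M \<Rightarrow> real^'N^'M \<Rightarrow> bool"
  where "is_row_threshold s X Z \<longleftrightarrow>
    (\<exists>S. card S = s \<and> (\<forall>i\<in>S. \<forall>j\<in>-S. norm (X $ j) \<le> norm (X $ i)) \<and> Z = restrict_rows S X)"

definition is_best_rank_approx :: "nat \<Rightarrow> real^'N^'M \<Rightarrow> real^'N^'M \<Rightarrow> bool"
  where "is_best_rank_approx k X Z \<longleftrightarrow> is_metric_proj (rank_le k) X Z"


text \<open>
  The \<open>k\<close> columns of the factors \<open>U\<close> and \<open>V\<close> are the families \<open>u i\<close>, \<open>v i\<close> with \<open>i < k\<close>;
  then \<open>U \<Sigma> V\<^sup>T = (\<Sum>i<k. \<sigma> i *\<^sub>R outer (u i) (v i))\<close> and \<open>U U\<^sup>T = gram k u\<close>.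
\<close>

definition outer :: "real^'M \<Rightarrow> real^'N \<Rightarrow> real^'N^'M"
  where "outer u v = (\<chi> i j. u $ i * v $ j)"

definition orthonormal_family :: "nat \<Rightarrow> (nat \<Rightarrow> 'a::real_inner) \<Rightarrow> bool"
  where "orthonormal_family k u \<longleftrightarrow> (\<forall>i<k. \<forall>j<k. u i \<bullet> u j = (if i = j then 1 else 0))"

definition thin_svd ::
    "nat \<Rightarrow> real^'N^'M \<Rightarrow> (nat \<Rightarrow> real^'M) \<Rightarrow> (nat \<Rightarrow> real) \<Rightarrow> (nat \<Rightarrow> real^'N) \<Rightarrow> bool"
  where "thin_svd k X u \<sigma> v \<longleftrightarrow>
    orthonormal_family k u \<and> orthonormal_family k v \<and> (\<forall>i<k. \<sigma> i > 0) \<and>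
    X = (\<Sum>i<k. \<sigma> i *\<^sub>R outer (u i) (v i))"

definition gram :: "nat \<Rightarrow> (nat \<Rightarrow> real^'M) \<Rightarrow> real^'M^'M"
  where "gram k u = (\<Sum>i<k. outer (u i) (u i))"

text \<open>
  \<open>is_tangent_proj k X P\<close>: \<open>P\<close> is an admissible choice of the operator \<open>P\<^sub>l\<close> at \<open>X = X\<^sub>l\<close>.
  The formula does not depend on the choice of the singular value decomposition.
\<close>

definition is_tangent_proj :: "nat \<Rightarrow> real^'N^'M \<Rightarrow> (real^'N^'M \<Rightarrow> real^'N^'M) \<Rightarrow> bool"
  where "is_tangent_proj k X P \<longleftrightarrow>
    (rank X = k \<longrightarrow>
      (\<exists>u \<sigma> v. thin_svd k X u \<sigma> v \<and>
        (\<forall>Z. P Z = gram k u ** Z + Z ** gram k v - gram k u ** Z ** gram k v))) \<and>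
    (rank X < k \<longrightarrow>
      (\<forall>Z. is_metric_proj (tangent_cone (rank_le k) X) Z (P Z)))"

text \<open>
  The sequence is indexed from \<open>1\<close>; \<open>X 0\<close> and \<open>P 0\<close> are irrelevant.
\<close>

definition riemannian_iht ::
    "nat \<Rightarrow> (real^'N^'M \<Rightarrow> real^'m) \<Rightarrow> real^'m \<Rightarrow>
     (real^'N^'M \<Rightarrow> real^'N^'M) \<Rightarrow> (real^'N^'M \<Rightarrow> real^'N^'M) \<Rightarrow> real \<Rightarrow>
     (nat \<Rightarrow> real^'N^'M \<Rightarrow> real^'N^'M) \<Rightarrow> (nat \<Rightarrow> real^'N^'M) \<Rightarrow> bool"
  where "riemannian_iht k A y H T \<alpha> P X \<longleftrightarrow>
    X 1 = (T \<circ> H) (\<alpha> *\<^sub>R adjoint A y) \<and>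
    (\<forall>l\<ge>1. is_tangent_proj k (X l) (P l) \<and>
      X (Suc l) = (T \<circ> H) (X l - P l (adjoint A (A (X l) - y))))"

end

theory Submission
  imports Defs
begin

text \<open>
  Put \<open>E = X - Xs\<close> for an iterate \<open>X\<close> close to \<open>Xs\<close>. One step of the iteration is shown to satisfy
  \<open>\<parallel>E'\<parallel> \<le> \<delta> \<parallel>E\<parallel> + C \<parallel>E\<parallel>\<^sup>2\<close> for the new error \<open>E'\<close> (\<open>riht_step_contraction\<close>); with \<open>\<delta> < 1\<close> this gives both
  local convergence and the asymptotic rate (\<open>eventual_linear_convergence\<close>).

  Every iterate has rank at most \<open>k\<close> and at most \<open>s\<close> nonzero rows. Since \<open>Xs\<close> has exactly \<open>s\<close> nonzero
  rows and rank exactly \<open>k\<close>, nearby iterates have the same row support and rank, and the thresholding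
  keeps precisely the rows in the support (\<open>restrict_rows_threshold_near\<close>, \<open>rank_lower_semicontinuous\<close>).
  Restricted to these rows, the tangent projection of the rank-\<open>k\<close> matrices becomes the orthogonal
  projection \<open>Q\<close> onto the tangent space at \<open>X\<close> of the matrices of rank at most \<open>k\<close> with rows in the
  support of \<open>Xs\<close>. The projected gradient step therefore has the error \<open>E - Q A\<^sup>* A E\<close>, which is
  \<open>Q (I - A\<^sup>* A) E\<close> up to the component of \<open>E\<close> normal to that tangent space.

  Everything then rests on one estimate: the orthogonal projectors onto the column and row spaces of
  a matrix are Lipschitz at \<open>Xs\<close> among matrices of no larger rank (\<open>range_projector_lipschitz\<close>). It
  implies that \<open>Q\<close> differs from the projection at \<open>Xs\<close> by a term of first order
  (\<open>tangent_op_perturbation\<close>), and that normal components of \<open>E\<close> are of second order, being products of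
  two projector differences (\<open>normal_component_bound\<close>). So the error after the gradient step is at most
  \<open>\<delta> \<parallel>E\<parallel>\<close> plus a quadratic term. The best rank-\<open>k\<close> approximation is not nonexpansive, but it is so up to
  a quadratic term near the rank-\<open>k\<close> matrix \<open>Xs\<close>, because its residual is normal to the tangent space
  (\<open>best_rank_approx_almost_nonexpansive\<close>).

  To bring in the hypothesis on \<open>\<delta>\<close>, the tangent space, given by velocities of curves, is identified
  with the range of the explicit projection \<open>tangent_op\<close> (\<open>tangent_space_eq_range\<close>): the quadratic bound
  on normal components kills the normal part of a velocity, and polynomial curves realise every
  tangential direction.
\<close>

section \<open>The Frobenius norm and inner product\<close>

lemma inner_transpose: "transpose A \<bullet> transpose B = A \<bullet> (B :: real^'n^'m)"
  unfolding inner_vec_def transpose_def by (simp, rule sum.swap)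

lemma norm_transpose: "norm (transpose A) = norm (A :: real^'n^'m)"
  by (simp add: norm_eq_sqrt_inner inner_transpose)

lemma norm_sq_rows: "(norm (A :: real^'n^'m))\<^sup>2 = (\<Sum>i\<in>UNIV. (norm (A $ i))\<^sup>2)"
  by (simp add: power2_norm_eq_inner inner_vec_def)

lemma norm_sq_components: "(norm (x :: real^'n))\<^sup>2 = (\<Sum>j\<in>UNIV. (x $ j)\<^sup>2)"
  unfolding power2_norm_eq_inner by (simp add: inner_vec_def power2_eq_square)

lemma matrix_mult_nth: "(A ** B) $ i $ j = A $ i \<bullet> column j (B :: real^'p^'n)"
  by (simp add: matrix_matrix_mult_def inner_vec_def column_def)

lemma norm_matrix_mult_le: "norm (A ** B) \<le> norm (A :: real^'n^'m) * norm (B :: real^'p^'n)"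
proof -
  have "(norm (A ** B))\<^sup>2 = (\<Sum>i\<in>UNIV. \<Sum>j\<in>UNIV. (A $ i \<bullet> column j B)\<^sup>2)"
    by (simp add: norm_sq_rows[of "A ** B"] norm_sq_components matrix_mult_nth)
  also have "\<dots> \<le> (\<Sum>i\<in>UNIV. \<Sum>j\<in>UNIV. (norm (A $ i))\<^sup>2 * (norm (column j B))\<^sup>2)"
    by (intro sum_mono) (metis Cauchy_Schwarz_ineq power2_norm_eq_inner)
  also have "\<dots> = (norm A)\<^sup>2 * (\<Sum>j\<in>UNIV. (norm (transpose B $ j))\<^sup>2)"
    by (simp add: norm_sq_rows sum_product transpose_def column_def)
  also have "\<dots> = (norm A * norm B)\<^sup>2"
    by (simp add: norm_sq_rows[symmetric] norm_transpose power_mult_distrib)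
  finally show ?thesis
    by (simp add: power2_le_iff_abs_le)
qed

lemma bounded_bilinear_matrix_mult:
  "bounded_bilinear (\<lambda>(A :: real^'n^'m) (B :: real^'p^'n). A ** B)"
proof
  show "\<exists>K. \<forall>A B. norm ((A :: real^'n^'m) ** (B :: real^'p^'n)) \<le> norm A * norm B * K"
    by (intro exI[of _ 1]) (simp add: norm_matrix_mult_le)
qed (simp_all add: matrix_matrix_mult_def vec_eq_iff distrib_left distrib_right sum.distrib
      sum_distrib_left ac_simps)

lemmas matrix_add_left = bounded_bilinear.add_left[OF bounded_bilinear_matrix_mult]
  and matrix_add_right = bounded_bilinear.add_right[OF bounded_bilinear_matrix_mult]
  and matrix_diff_left = bounded_bilinear.diff_left[OF bounded_bilinear_matrix_mult]
  and matrix_diff_right = bounded_bilinear.diff_right[OF bounded_bilinear_matrix_mult]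
  and matrix_scaleR_left = bounded_bilinear.scaleR_left[OF bounded_bilinear_matrix_mult]
  and matrix_scaleR_right = bounded_bilinear.scaleR_right[OF bounded_bilinear_matrix_mult]
  and matrix_sum_left = bounded_bilinear.sum_left[OF bounded_bilinear_matrix_mult]
  and matrix_sum_right = bounded_bilinear.sum_right[OF bounded_bilinear_matrix_mult]

lemmas matrix_distribs = matrix_add_left matrix_add_right matrix_diff_left matrix_diff_right
  matrix_scaleR_left matrix_scaleR_right

lemma inner_matrix_mult_left:
  "(A ** B) \<bullet> C = B \<bullet> (transpose A ** C)" for A :: "real^'n^'m" and B :: "real^'p^'n"
proof -
  have "(A ** B) \<bullet> C = (\<Sum>i\<in>UNIV. \<Sum>j\<in>UNIV. \<Sum>l\<in>UNIV. A $ i $ l * B $ l $ j * C $ i $ j)"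
    by (simp add: matrix_matrix_mult_def inner_vec_def sum_distrib_right)
  also have "\<dots> = (\<Sum>i\<in>UNIV. \<Sum>l\<in>UNIV. \<Sum>j\<in>UNIV. A $ i $ l * B $ l $ j * C $ i $ j)"
    by (intro sum.cong refl, rule sum.swap)
  also have "\<dots> = (\<Sum>l\<in>UNIV. \<Sum>i\<in>UNIV. \<Sum>j\<in>UNIV. A $ i $ l * B $ l $ j * C $ i $ j)"
    by (rule sum.swap)
  also have "\<dots> = (\<Sum>l\<in>UNIV. \<Sum>j\<in>UNIV. \<Sum>i\<in>UNIV. A $ i $ l * B $ l $ j * C $ i $ j)"
    by (intro sum.cong refl, rule sum.swap)
  also have "\<dots> = B \<bullet> (transpose A ** C)"
    by (simp add: matrix_matrix_mult_def inner_vec_def sum_distrib_left transpose_def ac_simps)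
  finally show ?thesis .
qed

lemma inner_matrix_mult_right:
  "(A ** B) \<bullet> C = A \<bullet> (C ** transpose B)" for A :: "real^'n^'m" and B :: "real^'p^'n"
  using inner_matrix_mult_left[of "transpose B" "transpose A" "transpose C"]
    inner_transpose[of "A ** B" C] inner_transpose[of A "C ** transpose B"]
  by (simp add: matrix_transpose_mul)

lemma transpose_diff: "transpose (A - B) = transpose A - transpose (B :: real^'n^'m)"
  by (simp add: transpose_def vec_eq_iff)

lemma transpose_sum: "transpose (\<Sum>i\<in>I. f i) = (\<Sum>i\<in>I. transpose (f i :: real^'n^'m))"
  by (simp add: transpose_def vec_eq_iff)


section \<open>Orthogonal projectors\<close>

definition orthogonal_projector :: "('a::real_inner \<Rightarrow> 'a) \<Rightarrow> bool"
  where "orthogonal_projector Q \<longleftrightarrow>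
    linear Q \<and> (\<forall>x. Q (Q x) = Q x) \<and> (\<forall>x y. Q x \<bullet> y = x \<bullet> Q y)"

lemma orthogonal_projector_norm_le:
  assumes "orthogonal_projector Q"
  shows "norm (Q x) \<le> norm x"
proof -
  have "(norm (Q x))\<^sup>2 = x \<bullet> Q x"
    using assms by (simp add: orthogonal_projector_def power2_norm_eq_inner)
  also have "\<dots> \<le> norm x * norm (Q x)"
    by (rule norm_cauchy_schwarz)
  finally show ?thesis
    by (cases "Q x = 0") (simp_all add: power2_eq_square)
qed

lemma orthogonal_projector_pythagoras:
  assumes "orthogonal_projector Q"
  shows "(norm x)\<^sup>2 = (norm (Q x))\<^sup>2 + (norm (x - Q x))\<^sup>2"
proof -
  have "Q x \<bullet> Q x = Q x \<bullet> x"
    using assms by (simp add: orthogonal_projector_def)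
  then show ?thesis
    by (simp add: power2_norm_eq_inner inner_diff_left inner_diff_right inner_commute)
qed

text \<open>
  Links the description of the projection onto a subspace by its defining property with the
  explicit operators used below.
\<close>

lemma orth_proj_range:
  assumes "orthogonal_projector Q"
  shows "orth_proj (range Q) = Q"
proof
  fix x
  have Q: "linear Q" "\<And>x. Q (Q x) = Q x" "\<And>x y. Q x \<bullet> y = x \<bullet> Q y"
    using assms by (auto simp: orthogonal_projector_def)
  show "orth_proj (range Q) x = Q x"
    unfolding orth_proj_def
  proof (rule the_equality)
    show "Q x \<in> range Q \<and> (\<forall>v\<in>range Q. orthogonal (x - Q x) v)"
      by (auto simp: orthogonal_def inner_diff_left Q)
  next
    fix p assume p: "p \<in> range Q \<and> (\<forall>v\<in>range Q. orthogonal (x - p) v)"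
    have Qp: "Q p = p"
      using p Q(2) by auto
    have "Q (x - p) \<bullet> Q (x - p) = 0"
      using p Q(2,3) by (auto simp: orthogonal_def)
    then show "p = Q x"
      using Qp by (simp add: linear_diff[OF Q(1)])
  qed
qed

section \<open>The orthogonal projector onto a column space\<close>

text \<open>
  The matrix \<open>p\<close> is the orthogonal projector \<open>X X\<^sup>+\<close> onto the column space of \<open>X\<close>. Asking for a factor
  \<open>B\<close> with \<open>p = X ** B\<close>, instead of asking that the ranges agree, turns the estimates and rank bounds
  below into matrix algebra; idempotence and uniqueness follow.
\<close>

definition range_projector :: "real^'n^'m \<Rightarrow> real^'m^'m \<Rightarrow> bool"
  where "range_projector X p \<longleftrightarrow> transpose p = p \<and> p ** X = X \<and> (\<exists>B. p = X ** B)"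

lemma range_projector_idem:
  assumes "range_projector X p"
  shows "p ** p = p"
  using assms by (metis matrix_mul_assoc range_projector_def)

lemma range_projector_unique:
  assumes "range_projector X p" "range_projector X p'"
  shows "p = p'"
proof -
  have "p' ** p = p" "p ** p' = p'"
    using assms by (metis matrix_mul_assoc range_projector_def)+
  then show ?thesis
    using assms by (metis matrix_transpose_mul range_projector_def)
qed

lemma range_projector_rank_le: "range_projector X p \<Longrightarrow> rank (p ** Y) \<le> rank X"
  by (metis (no_types) matrix_mul_assoc range_projector_def rank_mul_le_left)

lemma outer_mult_outer: "outer a b ** outer c d = (b \<bullet> c) *\<^sub>R outer a d"
  by (simp add: outer_def matrix_matrix_mult_def inner_vec_def vec_eq_iff sum_distrib_right
      sum_distrib_left ac_simps)

lemma matrix_mult_outer: "X ** outer a b = outer (X *v a) b"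
  by (simp add: outer_def matrix_matrix_mult_def matrix_vector_mult_def vec_eq_iff
      sum_distrib_left ac_simps)

lemma transpose_outer: "transpose (outer a b) = outer b a"
  by (simp add: outer_def transpose_def vec_eq_iff)

lemma inner_outer: "outer a b \<bullet> outer c d = (a \<bullet> c) * (b \<bullet> d)"
  by (simp add: outer_def inner_vec_def sum_product sum_distrib_left sum_distrib_right ac_simps)

lemma outer_mult_vec: "outer a b *v x = (b \<bullet> x) *\<^sub>R a"
  by (simp add: outer_def matrix_vector_mult_def inner_vec_def vec_eq_iff sum_distrib_left ac_simps)

lemma sum_mult_vec: "(\<Sum>i\<in>I. f i :: real^'n^'m) *v x = (\<Sum>i\<in>I. f i *v x)"
  by (induction I rule: infinite_finite_induct) (simp_all add: matrix_vector_mult_add_rdistrib)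

lemma transpose_gram: "transpose (gram k u) = gram k u"
  by (simp add: gram_def transpose_sum transpose_outer)

lemma gram_mult_outer:
  assumes "orthonormal_family k u" "j < k"
  shows "gram k u ** outer (u j) w = outer (u j) w"
proof -
  have "gram k u ** outer (u j) w = (\<Sum>i<k. (if i = j then 1 else 0) *\<^sub>R outer (u i) w)"
    using assms by (auto simp: gram_def matrix_sum_left outer_mult_outer orthonormal_family_def
        intro!: sum.cong)
  also have "\<dots> = (\<Sum>i<k. if i = j then outer (u i) w else 0)"
    by (intro sum.cong) auto
  finally show ?thesis
    using assms(2) by simp
qed

lemma gram_mult_vec:
  assumes "orthonormal_family k u" "j < k"
  shows "gram k u *v u j = u j"
proof -
  have "gram k u *v u j = (\<Sum>i<k. (if i = j then 1 else 0) *\<^sub>R u i)"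
    using assms by (auto simp: gram_def sum_mult_vec outer_mult_vec orthonormal_family_def
        intro!: sum.cong)
  also have "\<dots> = (\<Sum>i<k. if i = j then u i else 0)"
    by (intro sum.cong) auto
  finally show ?thesis
    using assms(2) by simp
qed

lemma norm_gram:
  assumes "orthonormal_family k u"
  shows "(norm (gram k u))\<^sup>2 = k"
proof -
  have "gram k u \<bullet> gram k u = (\<Sum>i<k. \<Sum>j<k. (u i \<bullet> u j) * (u i \<bullet> u j))"
    by (simp add: gram_def inner_sum_left inner_sum_right inner_outer) (rule sum.swap)
  also have "\<dots> = (\<Sum>i<k. \<Sum>j<k. if i = j then 1 else 0)"
    using assms by (intro sum.cong) (auto simp: orthonormal_family_def)
  finally show ?thesis
    by (simp add: power2_norm_eq_inner)
qed

text \<open>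
  With \<open>X = U \<Sigma> V\<^sup>T\<close> the factor is \<open>V \<Sigma>\<^sup>-\<^sup>1 U\<^sup>T\<close>. Only the projectors onto the column and row spaces of \<open>X\<close>
  enter the tangent projection, so no estimate below involves singular values.
\<close>

lemma thin_svd_range_projector:
  assumes "thin_svd k X u \<sigma> v"
  shows "range_projector X (gram k u)"
proof -
  have u: "orthonormal_family k u" and v: "orthonormal_family k v" and \<sigma>: "\<forall>i<k. \<sigma> i > 0"
    and X: "X = (\<Sum>i<k. \<sigma> i *\<^sub>R outer (u i) (v i))"
    using assms by (auto simp: thin_svd_def)
  have "gram k u ** X = X"
    by (simp add: X matrix_sum_right matrix_scaleR_right gram_mult_outer[OF u])
  moreover have "gram k u = X ** (\<Sum>j<k. (1 / \<sigma> j) *\<^sub>R outer (v j) (u j))"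
  proof -
    have Xv: "X *v v j = \<sigma> j *\<^sub>R u j" if "j < k" for j
    proof -
      have "X *v v j = (\<Sum>i<k. (if i = j then \<sigma> i else 0) *\<^sub>R u i)"
        using v that unfolding X
        by (auto simp: sum_mult_vec outer_mult_vec orthonormal_family_def
            scaleR_matrix_vector_assoc[symmetric] intro!: sum.cong)
      also have "\<dots> = (\<Sum>i<k. if i = j then \<sigma> i *\<^sub>R u i else 0)"
        by (intro sum.cong) auto
      finally show ?thesis
        using that by simp
    qed
    have "X ** (\<Sum>j<k. (1 / \<sigma> j) *\<^sub>R outer (v j) (u j)) =
        (\<Sum>j<k. (1 / \<sigma> j) *\<^sub>R outer (X *v v j) (u j))"
      by (simp add: matrix_sum_right matrix_scaleR_right matrix_mult_outer)
    also have "\<dots> = (\<Sum>j<k. outer (u j) (u j))"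
    proof (intro sum.cong refl)
      fix j assume "j \<in> {..<k}"
      then have "\<sigma> j \<noteq> 0" "X *v v j = \<sigma> j *\<^sub>R u j"
        using \<sigma> Xv by fastforce+
      then show "(1 / \<sigma> j) *\<^sub>R outer (X *v v j) (u j) = outer (u j) (u j)"
        by (simp add: outer_def vec_eq_iff)
    qed
    finally show ?thesis
      by (simp add: gram_def)
  qed
  ultimately show ?thesis
    unfolding range_projector_def using transpose_gram by blast
qed

lemma thin_svd_transpose: "thin_svd k X u \<sigma> v \<Longrightarrow> thin_svd k (transpose X) v \<sigma> u"
  by (auto simp: thin_svd_def transpose_sum transpose_scalar transpose_outer)

text \<open>
  Take an orthonormal basis of the column space and choose preimages of the basis vectors to build
  the factor. The Frobenius norm of a projector recovers its rank.
\<close>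

lemma range_projector_exists:
  fixes X :: "real^'n^'m"
  shows "\<exists>p. range_projector X p \<and> (norm p)\<^sup>2 = rank X"
proof -
  have "subspace (range ((*v) X))"
    by (simp add: linear_subspace_image)
  then obtain Bs where Bs: "Bs \<subseteq> range ((*v) X)" "pairwise orthogonal Bs"
      "\<And>x. x \<in> Bs \<Longrightarrow> norm x = 1" "independent Bs" "card Bs = dim (range ((*v) X))"
      "span Bs = range ((*v) X)"
    using orthonormal_basis_subspace[of "range ((*v) X)"] by blast
  have "finite Bs"
    using Bs(4) by (rule independent_imp_finite)
  then obtain u where u: "bij_betw u {0..<card Bs} Bs"
    using ex_bij_betw_nat_finite by blast
  define r where "r = rank X"
  have r: "card Bs = r"
    by (simp add: r_def Bs(5) rank_dim_range)
  have u_inj: "inj_on u {..<r}" and u_img: "u ` {..<r} = Bs"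
    using u by (auto simp: bij_betw_def r atLeast0LessThan)
  have uB: "u i \<in> Bs" if "i < r" for i
    using that u_img by auto
  have orth: "orthonormal_family r u"
    unfolding orthonormal_family_def
  proof (intro allI impI)
    fix i j assume ij: "i < r" "j < r"
    show "u i \<bullet> u j = (if i = j then 1 else 0)"
    proof (cases "i = j")
      case True
      then show ?thesis
        using Bs(3)[OF uB[OF ij(1)]] by (simp add: norm_eq_1)
    next
      case False
      then have "u i \<noteq> u j"
        using u_inj ij by (auto simp: inj_on_def)
      then show ?thesis
        using Bs(2) uB ij False by (auto simp: pairwise_def orthogonal_def)
    qed
  qed
  have fix_span: "gram r u *v y = y" if "y \<in> span Bs" for y
    using that
  proof (induction rule: span_induct)
    case base
    show ?case
      by (auto simp: subspace_def algebra_simps)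
  next
    case (step x)
    then show ?case
      using u_img gram_mult_vec[OF orth] by auto
  qed
  have "gram r u ** X = X"
    by (simp add: matrix_eq matrix_vector_mul_assoc[symmetric] fix_span Bs(6))
  moreover have "\<forall>i. \<exists>w. i < r \<longrightarrow> u i = X *v w"
    using uB Bs(1) by blast
  then obtain w where w: "\<And>i. i < r \<Longrightarrow> u i = X *v w i"
    by metis
  have "gram r u = X ** (\<Sum>i<r. outer (w i) (u i))"
    unfolding gram_def matrix_sum_right matrix_mult_outer
    by (intro sum.cong) (auto simp: w[symmetric])
  ultimately have "range_projector X (gram r u)"
    unfolding range_projector_def using transpose_gram by blast
  then show ?thesis
    using norm_gram[OF orth] r_def by blast
qed

lemma norm_range_projector:
  assumes "range_projector X p"
  shows "(norm p)\<^sup>2 = rank X"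
  using range_projector_exists[of X] range_projector_unique[OF assms] by auto

definition projection_matrix :: "real^'m^'m \<Rightarrow> bool"
  where "projection_matrix p \<longleftrightarrow> transpose p = p \<and> p ** p = p"

lemma range_projector_projection_matrix: "range_projector X p \<Longrightarrow> projection_matrix p"
  using range_projector_idem by (auto simp: projection_matrix_def range_projector_def)

lemma projection_matrix_mat_1: "projection_matrix (mat 1)"
  by (simp add: projection_matrix_def)

lemma orthogonal_projector_matrix_left:
  assumes "projection_matrix p"
  shows "orthogonal_projector (\<lambda>Z. p ** (Z :: real^'n^'m))"
  using assms by (auto simp: projection_matrix_def orthogonal_projector_def inner_matrix_mult_left
      matrix_mul_assoc matrix_distribs intro!: linearI)

lemma norm_projection_left_le:
  assumes "projection_matrix p"
  shows "norm (p ** Z) \<le> norm (Z :: real^'n^'m)"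
  using orthogonal_projector_norm_le[OF orthogonal_projector_matrix_left[OF assms]] .

lemma norm_projection_right_le:
  assumes "projection_matrix p"
  shows "norm (Z ** p) \<le> norm (Z :: real^'n^'m)"
  by (metis assms matrix_transpose_mul norm_projection_left_le norm_transpose projection_matrix_def)

lemma projection_matrix_diff:
  assumes p: "projection_matrix p" and d: "projection_matrix d" and dp: "d ** p = p"
  shows "p ** d = p" "projection_matrix (d - p)" "(d - p) ** p = 0" "p ** (d - p) = 0"
proof -
  have "transpose (d ** p) = p ** d"
    using p d by (simp add: matrix_transpose_mul projection_matrix_def)
  then show pd: "p ** d = p"
    using p dp by (simp add: projection_matrix_def)
  show "projection_matrix (d - p)" "(d - p) ** p = 0" "p ** (d - p) = 0"
    using p d by (simp_all add: projection_matrix_def matrix_diff_left matrix_diff_right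
        transpose_diff pd dp)
qed

text \<open>
  This is the perturbation estimate behind everything that follows. For projectors \<open>p\<close>, \<open>p'\<close> onto spaces
  of dimensions \<open>r\<close> and \<open>r' \<le> r\<close>,
  \<open>\<parallel>p' - p\<parallel>\<^sup>2 = r' + r - 2 \<parallel>p' p\<parallel>\<^sup>2 \<le> 2 (r - \<parallel>p' p\<parallel>\<^sup>2) = 2 \<parallel>(1 - p') p\<parallel>\<^sup>2\<close>,
  so the distance is controlled by the one-sided defect. Since \<open>p = Xs ** B\<close> and \<open>p'\<close> fixes \<open>X\<close>, this
  defect is \<open>(1 - p') (Xs - X) B\<close>, which is linear in \<open>X - Xs\<close>.
  Allowing the rank of \<open>X\<close> to be smaller covers degenerate matrices and yields the semicontinuity of
  the rank at \<open>Xs\<close>.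
\<close>

lemma range_projector_lipschitz:
  fixes Xs :: "real^'n^'m"
  assumes p: "range_projector Xs p"
  shows "\<exists>c\<ge>0. \<forall>X p'. range_projector X p' \<longrightarrow> rank X \<le> rank Xs \<longrightarrow>
    norm (p' - p) \<le> c * norm (X - Xs)"
proof -
  obtain B where B: "p = Xs ** B"
    using p by (auto simp: range_projector_def)
  have "norm (p' - p) \<le> (2 * norm B) * norm (X - Xs)"
    if p': "range_projector X p'" and rk: "rank X \<le> rank Xs" for X p'
  proof -
    have pm: "projection_matrix p" "projection_matrix p'"
      using p p' by (auto intro: range_projector_projection_matrix)
    then have sym: "transpose p = p" "transpose p' = p'" and idem: "p ** p = p" "p' ** p' = p'"
      by (auto simp: projection_matrix_def)
    have p'X: "p' ** X = X"
      using p' by (simp add: range_projector_def)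
    have "p' \<bullet> p = (p' ** p) \<bullet> (p' ** p)"
      using inner_matrix_mult_left[of p' p "p' ** p"] inner_matrix_mult_right[of p' p p]
      by (simp add: sym idem matrix_mul_assoc inner_commute)
    then have "(norm (p' - p))\<^sup>2 = (norm p')\<^sup>2 + (norm p)\<^sup>2 - 2 * (norm (p' ** p))\<^sup>2"
      by (simp add: power2_norm_eq_inner inner_diff_left inner_diff_right inner_commute)
    also have "\<dots> \<le> 2 * ((norm p)\<^sup>2 - (norm (p' ** p))\<^sup>2)"
      using rk by (simp add: norm_range_projector[OF p] norm_range_projector[OF p'])
    also have "\<dots> = 2 * (norm (p - p' ** p))\<^sup>2"
      using orthogonal_projector_pythagoras[OF orthogonal_projector_matrix_left[OF pm(2)], of p]
      by simp
    also have "\<dots> \<le> (2 * norm (p - p' ** p))\<^sup>2"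
      by (simp add: power_mult_distrib)
    finally have "norm (p' - p) \<le> 2 * norm (p - p' ** p)"
      by (rule power2_le_imp_le) simp
    also have "p - p' ** p = (mat 1 - p') ** (Xs - X) ** B"
    proof -
      have "(mat 1 - p') ** (Xs - X) = Xs - p' ** Xs"
        by (simp add: matrix_diff_left matrix_diff_right p'X)
      then show ?thesis
        by (simp only: matrix_diff_left B matrix_mul_assoc)
    qed
    also have "norm ((mat 1 - p') ** (Xs - X) ** B) \<le> norm ((mat 1 - p') ** (Xs - X)) * norm B"
      by (rule norm_matrix_mult_le)
    also have "norm ((mat 1 - p') ** (Xs - X)) \<le> norm (Xs - X)"
      using projection_matrix_diff(2)[OF pm(2) projection_matrix_mat_1]
      by (intro norm_projection_left_le) simp
    finally show ?thesis
      by (simp add: mult_right_mono norm_minus_commute[of Xs] mult.assoc mult.commute[of "norm B"])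
  qed
  moreover have "0 \<le> 2 * norm B"
    by simp
  ultimately show ?thesis
    by blast
qed

section \<open>Tangential and normal components\<close>

text \<open>
  With \<open>d = mat 1\<close> this is \<open>p Z + Z q - p Z q\<close>, the projection onto the tangent space of the rank-\<open>k\<close>
  matrices at the point with range projectors \<open>p\<close> and \<open>q\<close>. With \<open>d\<close> the coordinate projector onto a
  set of rows it is the projection onto the tangent space of the matrices that are in addition
  supported on these rows. Grouping the terms by the mutually orthogonal projectors \<open>p\<close> and \<open>d - p\<close>
  makes idempotence immediate.
\<close>

definition tangent_op :: "real^'m^'m \<Rightarrow> real^'m^'m \<Rightarrow> real^'n^'n \<Rightarrow> real^'n^'m \<Rightarrow> real^'n^'m"
  where "tangent_op d p q Z = p ** Z + (d - p) ** Z ** q"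

lemma orthogonal_projector_tangent_op:
  assumes p: "projection_matrix p" and q: "projection_matrix q" and d: "projection_matrix d"
    and dp: "d ** p = p"
  shows "orthogonal_projector (tangent_op d p q)"
proof -
  note dps = projection_matrix_diff[OF p d dp]
  have e: "transpose (d - p) = d - p" "(d - p) ** (d - p) = d - p"
    using dps(2) by (auto simp: projection_matrix_def)
  have pq: "transpose p = p" "p ** p = p" "transpose q = q" "q ** q = q"
    using p q by (auto simp: projection_matrix_def)
  have "linear (tangent_op d p q)"
    by (rule linearI) (simp_all add: tangent_op_def matrix_add_right matrix_add_left
        matrix_scaleR_right matrix_scaleR_left scaleR_add_right)
  moreover have "tangent_op d p q (tangent_op d p q Z) = tangent_op d p q Z" for Z
  proof -
    define w where "w = d - p"
    have w: "w ** w = w" "w ** p = 0" "p ** w = 0"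
      using dps e by (simp_all add: w_def)
    have "w ** Z ** q ** q = w ** Z ** q"
      by (metis matrix_mul_assoc pq(4))
    then show ?thesis
      unfolding tangent_op_def w_def[symmetric]
      by (simp add: matrix_add_right matrix_add_left matrix_mul_assoc w pq(2))
  qed
  moreover have "tangent_op d p q Y \<bullet> Z = Y \<bullet> tangent_op d p q Z" for Y Z
    by (simp add: tangent_op_def inner_add_left inner_add_right inner_matrix_mult_left[of p]
        inner_matrix_mult_left[of "d - p"] inner_matrix_mult_right[of _ q] e pq
        matrix_mul_assoc)
  ultimately show ?thesis
    by (simp add: orthogonal_projector_def)
qed

lemma tangent_op_residual:
  assumes "d ** Z = Z"
  shows "Z - tangent_op d p q Z = (d - p) ** Z ** (mat 1 - q)"
  using assms by (simp add: tangent_op_def matrix_diff_left matrix_diff_right)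

definition range_projectors :: "real^'n^'m \<Rightarrow> real^'m^'m \<Rightarrow> real^'n^'n \<Rightarrow> bool"
  where "range_projectors X p q \<longleftrightarrow> range_projector X p \<and> range_projector (transpose X) q"

lemma range_projectors_exist: "\<exists>p q. range_projectors X p q"
  using range_projector_exists[of X] range_projector_exists[of "transpose X"]
  unfolding range_projectors_def by blast

lemma range_projectors_D:
  assumes "range_projectors X p q"
  shows "projection_matrix p" "projection_matrix q" "p ** X = X" "X ** q = X"
proof -
  show "projection_matrix p" "projection_matrix q" "p ** X = X"
    using assms by (auto simp: range_projectors_def intro: range_projector_projection_matrix)
      (simp add: range_projector_def)
  have "transpose (q ** transpose X) = X ** q"
    using assms unfolding matrix_transpose_mul
    by (simp add: range_projectors_def range_projector_def)
  moreover have "q ** transpose X = transpose X"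
    using assms by (simp add: range_projectors_def range_projector_def)
  ultimately show "X ** q = X"
    by simp
qed

lemma range_projectors_factor:
  assumes "range_projectors X p q"
  shows "\<exists>B C. p = X ** B \<and> q = C ** X"
proof -
  obtain B C where "p = X ** B" "q = transpose X ** C" "transpose q = q"
    using assms by (auto simp: range_projectors_def range_projector_def)
  then show ?thesis
    by (metis matrix_transpose_mul transpose_transpose)
qed

lemma range_projectors_rows:
  assumes "range_projectors X p q" "d ** X = X"
  shows "d ** p = p"
  using range_projectors_factor[OF assms(1)] assms(2) by (metis matrix_mul_assoc)

lemma range_projectors_lipschitz:
  assumes "range_projectors Xs p q"
  shows "\<exists>c\<ge>0. \<forall>X p' q'. range_projectors X p' q' \<longrightarrow> rank X \<le> rank Xs \<longrightarrow>
    norm (p' - p) \<le> c * norm (X - Xs) \<and> norm (q' - q) \<le> c * norm (X - Xs)"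
proof -
  obtain a where a: "a \<ge> 0" "\<And>X p'. range_projector X p' \<Longrightarrow> rank X \<le> rank Xs \<Longrightarrow>
      norm (p' - p) \<le> a * norm (X - Xs)"
    using range_projector_lipschitz[of Xs p] assms by (auto simp: range_projectors_def)
  obtain b where b: "b \<ge> 0" "\<And>X q'. range_projector X q' \<Longrightarrow> rank X \<le> rank (transpose Xs) \<Longrightarrow>
      norm (q' - q) \<le> b * norm (X - transpose Xs)"
    using range_projector_lipschitz[of "transpose Xs" q] assms by (auto simp: range_projectors_def)
  have "norm (p' - p) \<le> max a b * norm (X - Xs) \<and> norm (q' - q) \<le> max a b * norm (X - Xs)"
    if "range_projectors X p' q'" "rank X \<le> rank Xs" for X p' q'
  proof
    have "norm (p' - p) \<le> a * norm (X - Xs)"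
      using a that by (simp add: range_projectors_def)
    also have "\<dots> \<le> max a b * norm (X - Xs)"
      by (intro mult_right_mono) auto
    finally show "norm (p' - p) \<le> max a b * norm (X - Xs)" .
    have "norm (q' - q) \<le> b * norm (transpose X - transpose Xs)"
      using b(2)[of "transpose X"] that by (simp add: range_projectors_def rank_transpose)
    also have "norm (transpose X - transpose Xs) = norm (X - Xs)"
      by (metis norm_transpose transpose_diff)
    also have "b * norm (X - Xs) \<le> max a b * norm (X - Xs)"
      by (intro mult_right_mono) auto
    finally show "norm (q' - q) \<le> max a b * norm (X - Xs)" .
  qed
  moreover have "max a b \<ge> 0"
    using a(1) by simp
  ultimately show ?thesis
    by blast
qed

text \<open>
  Curvature is a second-order effect: because \<open>p' X = X = X q'\<close> and \<open>d X = X\<close>, the normal component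
  equals \<open>(p' - p) X (q' - q)\<close>, a product of two factors of first order. The roles of the two points
  can be exchanged, so the lemma bounds the normal component of \<open>X\<close> at \<open>Xs\<close> as well as that of \<open>Xs\<close>
  at \<open>X\<close>.
\<close>

lemma normal_component_bound:
  assumes "range_projectors X p' q'" "d ** X = X"
    and "norm (p' - p) \<le> c * e" "norm (q' - q) \<le> c * e"
  shows "norm ((d - p) ** X ** (mat 1 - q)) \<le> c\<^sup>2 * norm X * e\<^sup>2"
proof -
  have "p' ** X = X" "X ** q' = X"
    using range_projectors_D[OF assms(1)] by auto
  then have "(d - p) ** X ** (mat 1 - q) = (p' - p) ** X ** (q' - q)"
  proof -
    have "(d - p) ** X ** (mat 1 - q) = (p' ** X - p ** X) ** (mat 1 - q)"
      using assms(2) \<open>p' ** X = X\<close> by (simp add: matrix_diff_left)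
    also have "\<dots> = (p' - p) ** (X ** q' - X ** q)"
      using \<open>X ** q' = X\<close> by (simp add: matrix_diff_left matrix_diff_right matrix_mul_assoc)
    finally show ?thesis
      by (simp add: matrix_diff_right matrix_mul_assoc)
  qed
  also have "norm \<dots> \<le> norm (p' - p) * norm X * norm (q' - q)"
    by (meson mult_right_mono norm_ge_zero norm_matrix_mult_le order_trans)
  also have "\<dots> \<le> (c * e) * norm X * (c * e)"
  proof -
    have "0 \<le> c * e"
      using assms(3) norm_ge_zero order_trans by blast
    then show ?thesis
      using assms(3,4) by (intro mult_mono) auto
  qed
  finally show ?thesis
    by (simp add: power2_eq_square ac_simps)
qed

section \<open>Best low-rank approximation near a matrix of the target rank\<close>

lemma rank_le_transpose: "transpose X \<in> rank_le k \<longleftrightarrow> X \<in> rank_le k"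
  by (simp add: rank_le_def rank_transpose)

lemma best_rank_approx_transpose:
  assumes "is_best_rank_approx k Y Z"
  shows "is_best_rank_approx k (transpose Y) (transpose Z)"
proof -
  have d: "dist (transpose Y) q = dist Y (transpose q)" for q
    by (metis dist_norm norm_transpose transpose_diff transpose_transpose)
  show ?thesis
    using assms by (auto simp: is_best_rank_approx_def is_metric_proj_def d rank_le_transpose)
qed

text \<open>
  Otherwise \<open>p ** Y\<close>, whose rank is at most \<open>k\<close>, would be strictly closer to \<open>Y\<close> by Pythagoras.
\<close>

lemma best_rank_approx_left_projection:
  assumes best: "is_best_rank_approx k Y Z" and p: "range_projector Z p"
  shows "p ** Y = Z"
proof -
  have "rank Z \<le> k" and le: "\<And>W. rank W \<le> k \<Longrightarrow> norm (Y - Z) \<le> norm (Y - W)"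
    using best by (auto simp: is_best_rank_approx_def is_metric_proj_def rank_le_def dist_norm)
  then have "norm (Y - Z) \<le> norm (Y - p ** Y)"
    using range_projector_rank_le[OF p, of Y] by (intro le) simp
  moreover have "p ** (Y - Z) = p ** Y - Z" "Y - Z - (p ** Y - Z) = Y - p ** Y"
    using p by (simp_all add: range_projector_def matrix_diff_right)
  then have "(norm (Y - Z))\<^sup>2 = (norm (p ** Y - Z))\<^sup>2 + (norm (Y - p ** Y))\<^sup>2"
    using orthogonal_projector_pythagoras[OF orthogonal_projector_matrix_left
        [OF range_projector_projection_matrix[OF p]], of "Y - Z"] by simp
  ultimately have "(norm (p ** Y - Z))\<^sup>2 \<le> 0"
    using power_mono[of "norm (Y - Z)" "norm (Y - p ** Y)" 2] by simp
  then show ?thesis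
    by simp
qed

text \<open>
  Masking the rows of \<open>Z\<close> does not raise its rank and brings it strictly closer to \<open>Y\<close>, unless the
  discarded rows vanish. Hence low-rank approximation does not enlarge the row support.
\<close>

lemma best_rank_approx_rows:
  assumes best: "is_best_rank_approx k Y Z" and d: "projection_matrix d" "d ** Y = Y"
  shows "d ** Z = Z"
proof -
  have "rank Z \<le> k" and le: "\<And>W. rank W \<le> k \<Longrightarrow> norm (Y - Z) \<le> norm (Y - W)"
    using best by (auto simp: is_best_rank_approx_def is_metric_proj_def rank_le_def dist_norm)
  then have "norm (Y - Z) \<le> norm (Y - d ** Z)"
    using rank_mul_le_right[of d Z] by (intro le) simp
  moreover have "d ** (Y - Z) = Y - d ** Z" "Y - Z - (Y - d ** Z) = d ** Z - Z"
    using d by (simp_all add: matrix_diff_right)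
  then have "(norm (Y - Z))\<^sup>2 = (norm (Y - d ** Z))\<^sup>2 + (norm (d ** Z - Z))\<^sup>2"
    using orthogonal_projector_pythagoras[OF orthogonal_projector_matrix_left[OF d(1)], of "Y - Z"]
    by simp
  ultimately have "(norm (d ** Z - Z))\<^sup>2 \<le> 0"
    using power_mono[of "norm (Y - Z)" "norm (Y - d ** Z)" 2] by simp
  then show ?thesis
    by simp
qed

text \<open>
  That \<open>Z\<close> is no farther from \<open>Y\<close> than \<open>Xs\<close> gives only \<open>\<parallel>Z - Xs\<parallel> \<le> 2 \<parallel>Y - Xs\<parallel>\<close>, and the factor \<open>2\<close>
  would ruin the rate. The residual \<open>Y - Z\<close>, however, is normal to the tangent space at \<open>Z\<close>, so the
  tangential part of \<open>Z - Xs\<close> is the projection of \<open>Y - Xs\<close>, while its normal part is of second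
  order.
\<close>

lemma best_rank_approx_almost_nonexpansive:
  fixes Xs :: "real^'n^'m"
  shows "\<exists>C\<ge>0. \<forall>Y Z. is_best_rank_approx (rank Xs) Y Z \<longrightarrow>
    norm (Z - Xs) \<le> norm (Y - Xs) + C * (norm (Y - Xs))\<^sup>2"
proof -
  obtain ps qs where pqs: "range_projectors Xs ps qs"
    using range_projectors_exist by blast
  obtain c where c: "c \<ge> 0" "\<And>X p' q'. range_projectors X p' q' \<Longrightarrow> rank X \<le> rank Xs \<Longrightarrow>
      norm (p' - ps) \<le> c * norm (X - Xs) \<and> norm (q' - qs) \<le> c * norm (X - Xs)"
    using range_projectors_lipschitz[OF pqs] by blast
  have "norm (Z - Xs) \<le> norm (Y - Xs) + 4 * c\<^sup>2 * norm Xs * (norm (Y - Xs))\<^sup>2"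
    if best: "is_best_rank_approx (rank Xs) Y Z" for Y Z
  proof -
    obtain p q where pq: "range_projectors Z p q"
      using range_projectors_exist by blast
    define P where "P = tangent_op (mat 1) p q"
    note pqD = range_projectors_D[OF pq]
    have P: "orthogonal_projector P"
      unfolding P_def by (rule orthogonal_projector_tangent_op) (simp_all add: pqD projection_matrix_mat_1)
    have rk: "rank Z \<le> rank Xs" and "dist Y Z \<le> dist Y Xs"
      using best by (auto simp: is_best_rank_approx_def is_metric_proj_def rank_le_def)
    then have Z2: "norm (Z - Xs) \<le> 2 * norm (Y - Xs)"
      using norm_triangle_ineq[of "Z - Y" "Y - Xs"] by (simp add: dist_norm norm_minus_commute)
    have "p ** Y = Z"
      using best pq by (auto simp: range_projectors_def intro: best_rank_approx_left_projection)
    moreover have "q ** transpose Y = transpose Z"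
      using best_rank_approx_transpose[OF best] pq
      by (auto simp: range_projectors_def intro: best_rank_approx_left_projection)
    then have "Y ** q = Z"
      by (metis matrix_transpose_mul pqD(2) projection_matrix_def transpose_transpose)
    ultimately have "P (Y - Z) = 0"
      by (simp add: P_def tangent_op_def matrix_diff_left matrix_diff_right pqD matrix_mul_assoc[symmetric])
    then have "P (Z - Xs) = P (Y - Xs)"
      using P by (simp add: orthogonal_projector_def linear_diff)
    moreover have "(Z - Xs) - P (Z - Xs) = - ((mat 1 - p) ** Xs ** (mat 1 - q))"
      unfolding P_def by (subst tangent_op_residual)
        (simp_all add: matrix_diff_left matrix_diff_right pqD)
    ultimately have "Z - Xs = P (Y - Xs) - (mat 1 - p) ** Xs ** (mat 1 - q)"
      by (simp add: diff_eq_eq)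
    then have "norm (Z - Xs) \<le> norm (P (Y - Xs)) + norm ((mat 1 - p) ** Xs ** (mat 1 - q))"
      by (metis norm_triangle_ineq4)
    also have "norm (P (Y - Xs)) \<le> norm (Y - Xs)"
      by (rule orthogonal_projector_norm_le[OF P])
    also have "norm ((mat 1 - p) ** Xs ** (mat 1 - q)) \<le> c\<^sup>2 * norm Xs * (norm (Z - Xs))\<^sup>2"
      using c(2)[OF pq rk] by (intro normal_component_bound[OF pqs]) (auto simp: norm_minus_commute)
    also have "\<dots> \<le> c\<^sup>2 * norm Xs * (2 * norm (Y - Xs))\<^sup>2"
      using Z2 by (intro mult_left_mono power_mono) auto
    finally show ?thesis
      by (simp add: power_mult_distrib)
  qed
  moreover have "4 * c\<^sup>2 * norm Xs \<ge> 0"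
    by simp
  ultimately show ?thesis
    by blast
qed

section \<open>The tangent space with prescribed row support\<close>

definition row_mask :: "'m set \<Rightarrow> real^'m^'m"
  where "row_mask S = restrict_rows S (mat 1)"

lemma restrict_rows_eq_row_mask: "restrict_rows S Z = row_mask S ** Z"
proof -
  have "(row_mask S ** Z) $ i $ j = (if i \<in> S then (mat 1 ** Z) $ i $ j else 0)" for i j
    by (simp only: row_mask_def restrict_rows_def matrix_matrix_mult_def vec_lambda_beta) simp
  then show ?thesis
    by (simp add: restrict_rows_def vec_eq_iff)
qed

lemma projection_matrix_row_mask: "projection_matrix (row_mask S)"
proof -
  have "row_mask S ** row_mask S = row_mask S"
    unfolding restrict_rows_eq_row_mask[symmetric]
    by (simp add: row_mask_def restrict_rows_def vec_eq_iff)
  moreover have "transpose (row_mask S) = row_mask S"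
    by (auto simp: row_mask_def restrict_rows_def vec_eq_iff transpose_def mat_def)
  ultimately show ?thesis
    by (simp add: projection_matrix_def)
qed

lemma row_mask_mult_eq_iff: "row_mask S ** X = X \<longleftrightarrow> row_support X \<subseteq> S"
  unfolding restrict_rows_eq_row_mask[symmetric]
  by (auto simp: restrict_rows_def row_support_def vec_eq_iff)

lemma has_vector_derivative_quotient:
  assumes "(g has_vector_derivative w) (at 0)"
  shows "((\<lambda>t. (1 / t) *\<^sub>R (g t - g 0)) \<longlongrightarrow> w) (at 0)"
proof -
  have "((\<lambda>t. norm (g (0 + t) - g 0 - t *\<^sub>R w) / norm t) \<longlongrightarrow> 0) (at 0)"
    using assms unfolding has_vector_derivative_def has_derivative_at by blast
  moreover have "\<forall>\<^sub>F t in at 0. norm (g (0 + t) - g 0 - t *\<^sub>R w) / norm t =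
      norm ((1 / t) *\<^sub>R (g t - g 0) - w)"
  proof (rule eventually_at_filter[THEN iffD2, OF always_eventually], intro allI impI)
    fix t :: real assume t: "t \<noteq> 0"
    have "(1 / t) *\<^sub>R (g t - g 0) - w = (1 / t) *\<^sub>R (g t - g 0 - t *\<^sub>R w)"
      using t by (simp add: scaleR_diff_right)
    then show "norm (g (0 + t) - g 0 - t *\<^sub>R w) / norm t = norm ((1 / t) *\<^sub>R (g t - g 0) - w)"
      by simp
  qed
  ultimately have "((\<lambda>t. norm ((1 / t) *\<^sub>R (g t - g 0) - w)) \<longlongrightarrow> 0) (at 0)"
    by (rule Lim_transform_eventually)
  then show ?thesis
    by (simp add: tendsto_norm_zero_iff LIM_zero_iff)
qed

text \<open>
  Along a curve \<open>c\<close> in the variety through \<open>Xs\<close>, the normal component of \<open>c t\<close> is bounded by a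
  multiple of \<open>\<parallel>c t - Xs\<parallel>\<^sup>2 = O(t\<^sup>2)\<close>, so its derivative at \<open>0\<close>, the normal component of the velocity,
  vanishes.
\<close>

lemma tangent_space_subset:
  fixes Xs :: "real^'n^'m"
  assumes pq: "range_projectors Xs p q" and rk: "rank Xs = k"
    and v: "v \<in> tangent_space (rank_le_rows_in k S) Xs"
  shows "row_mask S ** v = v" "(row_mask S - p) ** v ** (mat 1 - q) = 0"
proof -
  define d where "d = row_mask S"
  obtain e c where e: "e > 0" and c0: "c 0 = Xs" and cS: "c ` {-e<..<e} \<subseteq> rank_le_rows_in k S"
    and der: "(c has_vector_derivative v) (at 0)"
    using v by (auto simp: tangent_space_def)
  have cD: "rank (c t) \<le> k" "d ** c t = c t" if "t \<in> {-e<..<e}" for t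
  proof -
    have "c t \<in> rank_le_rows_in k S"
      using cS that by blast
    then show "rank (c t) \<le> k" "d ** c t = c t"
      by (auto simp: rank_le_rows_in_def rank_le_def d_def row_mask_mult_eq_iff)
  qed
  have bl: "bounded_linear (\<lambda>Z :: real^'n^'m. d ** Z)"
    by (rule bounded_bilinear.bounded_linear_right[OF bounded_bilinear_matrix_mult])
  have bl2: "bounded_linear (\<lambda>Z :: real^'n^'m. (d - p) ** Z ** (mat 1 - q))"
    by (rule bounded_linear_compose[OF bounded_bilinear.bounded_linear_left
          [OF bounded_bilinear_matrix_mult] bounded_bilinear.bounded_linear_right
          [OF bounded_bilinear_matrix_mult]])
  have "((\<lambda>t. d ** c t) has_vector_derivative d ** v) (at 0)"
    by (rule bounded_linear.has_vector_derivative[OF bl der])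
  then have "(c has_vector_derivative d ** v) (at 0)"
    by (rule has_vector_derivative_transform_within_open[where S = "{-e<..<e}"])
      (use e cD in auto)
  then show dv: "row_mask S ** v = v"
    using der vector_derivative_unique_at unfolding d_def by blast
  define h where "h t = (d - p) ** c t ** (mat 1 - q)" for t
  define w where "w = (d - p) ** v ** (mat 1 - q)"
  have dp: "d ** Xs = Xs"
    using cD(2)[of 0] e c0 by simp
  have h0: "h 0 = 0"
    using dp range_projectors_D[OF pq] by (simp add: h_def c0 matrix_diff_left)
  have "(h has_vector_derivative w) (at 0)"
    using bounded_linear.has_vector_derivative[OF bl2 der] unfolding h_def[abs_def] w_def .
  then have "((\<lambda>t. (1 / t) *\<^sub>R h t) \<longlongrightarrow> w) (at 0)"
    using has_vector_derivative_quotient[of h w] h0 by simp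
  then have lim1: "((\<lambda>t. norm ((1 / t) *\<^sub>R h t)) \<longlongrightarrow> norm w) (at 0)"
    by (rule tendsto_norm)
  obtain a where a: "a \<ge> 0" "\<And>X p' q'. range_projectors X p' q' \<Longrightarrow> rank X \<le> rank Xs \<Longrightarrow>
      norm (p' - p) \<le> a * norm (X - Xs) \<and> norm (q' - q) \<le> a * norm (X - Xs)"
    using range_projectors_lipschitz[OF pq] by blast
  have bound: "norm ((1 / t) *\<^sub>R h t)
      \<le> a\<^sup>2 * norm (c t) * norm ((1 / t) *\<^sub>R (c t - c 0)) * norm (c t - c 0)"
    if "t \<in> {-e<..<e}" for t
  proof -
    obtain p' q' where "range_projectors (c t) p' q'"
      using range_projectors_exist by blast
    then have "norm (h t) \<le> a\<^sup>2 * norm (c t) * (norm (c t - Xs))\<^sup>2"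
      unfolding h_def using cD[OF that] a(2) rk
      by (intro normal_component_bound[of "c t" p' q']) auto
    then have "\<bar>1 / t\<bar> * norm (h t) \<le> \<bar>1 / t\<bar> * (a\<^sup>2 * norm (c t) * (norm (c t - Xs))\<^sup>2)"
      by (rule mult_left_mono) simp
    then show ?thesis
      unfolding norm_scaleR c0 by (simp only: power2_eq_square ac_simps)
  qed
  have "isCont c 0"
    using der has_vector_derivative_continuous by blast
  then have cont: "(c \<longlongrightarrow> c 0) (at 0)"
    by (simp add: isCont_def)
  have "((\<lambda>t. a\<^sup>2 * norm (c t) * norm ((1 / t) *\<^sub>R (c t - c 0)) * norm (c t - c 0)) \<longlongrightarrow>
      a\<^sup>2 * norm (c 0) * norm v * norm (c 0 - c 0)) (at 0)"
    by (intro tendsto_intros cont has_vector_derivative_quotient der)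
  then have lim2: "((\<lambda>t. a\<^sup>2 * norm (c t) * norm ((1 / t) *\<^sub>R (c t - c 0)) * norm (c t - c 0)) \<longlongrightarrow> 0) (at 0)"
    by simp
  have "\<forall>\<^sub>F t in at 0. t \<in> {-e<..<e}"
    using e by (intro eventually_at_in_open') auto
  then have "norm w \<le> 0"
    by (intro tendsto_le[OF _ lim2 lim1]) (auto elim!: eventually_mono simp del: norm_scaleR intro: bound)
  then show "(row_mask S - p) ** v ** (mat 1 - q) = 0"
    by (simp add: w_def d_def)
qed

text \<open>
  A fixed vector of the projection has the form \<open>v = Xs R + L Xs\<close>, where \<open>L\<close> maps into the admissible
  rows. Then \<open>(1 + t L) Xs (1 + t R)\<close> is a polynomial curve in the variety with velocity \<open>v\<close>.
\<close>

lemma tangent_space_superset: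
  fixes Xs :: "real^'n^'m"
  assumes pq: "range_projectors Xs p q" and rk: "rank Xs = k" and S: "row_support Xs \<subseteq> S"
    and v: "tangent_op (row_mask S) p q v = v"
  shows "v \<in> tangent_space (rank_le_rows_in k S) Xs"
proof -
  define d where "d = row_mask S"
  have dX: "d ** Xs = Xs"
    using S by (simp add: d_def row_mask_mult_eq_iff)
  have d: "projection_matrix d"
    by (simp add: d_def projection_matrix_row_mask)
  note pqD = range_projectors_D[OF pq]
  have dp: "d ** p = p"
    by (rule range_projectors_rows[OF pq dX])
  obtain B C where B: "p = Xs ** B" and C: "q = C ** Xs"
    using range_projectors_factor[OF pq] by blast
  define L where "L = (d - p) ** v ** C"
  define R where "R = B ** v"
  define c where "c t = (mat 1 + t *\<^sub>R L) ** Xs ** (mat 1 + t *\<^sub>R R)" for t :: real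
  have v_eq: "v = Xs ** R + L ** Xs"
    using v by (simp add: tangent_op_def L_def R_def d_def[symmetric] B C matrix_mul_assoc)
  have dL: "d ** L = L"
    using d dp by (simp add: L_def matrix_mul_assoc matrix_diff_right projection_matrix_def)
  have c_eq: "c t = Xs + t *\<^sub>R v + t\<^sup>2 *\<^sub>R (L ** Xs ** R)" for t
    by (simp add: c_def v_eq matrix_distribs power2_eq_square scaleR_add_right matrix_mul_assoc)
  have der: "(c has_vector_derivative v + (2 * t) *\<^sub>R (L ** Xs ** R)) (at t)" for t
    unfolding c_eq by (auto intro!: derivative_eq_intros)
  have "c C1_differentiable_on {-1<..<1}"
    unfolding C1_differentiable_on_def
    by (intro exI[of _ "\<lambda>t. v + (2 * t) *\<^sub>R (L ** Xs ** R)"] conjI ballI der continuous_intros)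
  moreover have "(c has_vector_derivative v) (at 0)"
    using der[of 0] by simp
  moreover have "c t \<in> rank_le_rows_in k S" for t
  proof -
    have "rank (c t) \<le> k"
      unfolding c_def rk[symmetric] by (metis order_trans rank_mul_le_left rank_mul_le_right)
    moreover have "d ** c t = c t"
      by (simp add: c_def matrix_mul_assoc matrix_distribs dX dL)
    ultimately show ?thesis
      by (simp add: rank_le_rows_in_def rank_le_def d_def row_mask_mult_eq_iff)
  qed
  moreover have "c 0 = Xs"
    by (simp add: c_def)
  ultimately show ?thesis
    unfolding tangent_space_def by (auto intro!: exI[of _ 1] exI[of _ c])
qed

lemma tangent_space_eq_range:
  assumes pq: "range_projectors Xs p q" and rk: "rank Xs = k" and S: "row_support Xs \<subseteq> S"
  shows "tangent_space (rank_le_rows_in k S) Xs = range (tangent_op (row_mask S) p q)"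
proof -
  define Q where "Q = tangent_op (row_mask S) p q"
  have "orthogonal_projector Q"
    unfolding Q_def using range_projectors_D[OF pq] S
    by (intro orthogonal_projector_tangent_op projection_matrix_row_mask
        range_projectors_rows[OF pq]) (auto simp: row_mask_mult_eq_iff)
  then have "v \<in> range Q \<longleftrightarrow> Q v = v" for v
    unfolding orthogonal_projector_def by (metis rangeE rangeI)
  moreover have "v \<in> tangent_space (rank_le_rows_in k S) Xs \<longleftrightarrow> Q v = v" for v
    using tangent_space_subset[OF pq rk, of v S] tangent_space_superset[OF pq rk S, of v]
      tangent_op_residual[of "row_mask S" v p q] unfolding Q_def by auto
  ultimately show ?thesis
    unfolding Q_def by blast
qed

section \<open>Stability of row support and rank\<close>

text \<open>
  The norms of the rows of \<open>Xs\<close> indexed by \<open>S\<close> are bounded away from \<open>0\<close>. For nearby \<open>W\<close> these rows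
  therefore dominate all others, and any admissible thresholding selects exactly \<open>S\<close>.
\<close>

lemma restrict_rows_threshold_near:
  fixes Xs :: "real^'n^'m"
  assumes S: "S = row_support Xs" and cS: "card S = s"
  shows "\<exists>\<rho>>0. \<forall>W. norm (W - Xs) < \<rho> \<longrightarrow>
    (card (row_support W) \<le> s \<longrightarrow> row_support W = S) \<and>
    (\<forall>Z. is_row_threshold s W Z \<longrightarrow> Z = restrict_rows S W)"
proof -
  \<comment> \<open>Half the smallest norm of a nonzero row, but at most \<open>1 / 2\<close>; the element \<open>1\<close> keeps the set nonempty.\<close>
  define \<rho> where "\<rho> = Min (insert 1 ((\<lambda>i. norm (Xs $ i)) ` S)) / 2"
  have "\<rho> > 0"
    by (auto simp: \<rho>_def S row_support_def)
  have \<rho>: "2 * \<rho> \<le> norm (Xs $ i)" if "i \<in> S" for i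
    using that by (auto simp: \<rho>_def)
  have zero: "Xs $ i = 0" if "i \<notin> S" for i
    using that by (auto simp: S row_support_def)
  have "(card (row_support W) \<le> s \<longrightarrow> row_support W = S) \<and>
      (\<forall>Z. is_row_threshold s W Z \<longrightarrow> Z = restrict_rows S W)" if W: "norm (W - Xs) < \<rho>" for W
  proof -
    have row: "norm (W $ i - Xs $ i) < \<rho>" for i
      using Finite_Cartesian_Product.norm_nth_le[of "W - Xs" i] W by simp
    have large: "\<rho> < norm (W $ i)" if "i \<in> S" for i
      using \<rho>[OF that] row[of i] norm_triangle_ineq2[of "Xs $ i" "W $ i"]
      by (simp add: norm_minus_commute)
    have small: "norm (W $ i) < \<rho>" if "i \<notin> S" for i
      using row[of i] zero[OF that] by simp
    have "S \<subseteq> row_support W"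
      using large \<open>\<rho> > 0\<close> by (force simp: row_support_def)
    then have "row_support W = S" if "card (row_support W) \<le> s"
      using card_seteq[of "row_support W" S] that cS by simp
    moreover have "Z = restrict_rows S W" if thr: "is_row_threshold s W Z" for Z
    proof -
      obtain S' where S': "card S' = s" "\<forall>i\<in>S'. \<forall>j\<in>-S'. norm (W $ j) \<le> norm (W $ i)"
          "Z = restrict_rows S' W"
        using thr unfolding is_row_threshold_def by blast
      have "S' \<subseteq> S"
      proof (rule ccontr)
        assume "\<not> S' \<subseteq> S"
        then obtain i where i: "i \<in> S'" "i \<notin> S"
          by blast
        then have "\<not> S \<subseteq> S'"
          using card_seteq[of S' S] S'(1) cS by auto
        then obtain j where j: "j \<in> S" "j \<notin> S'"
          by blast
        have "norm (W $ j) \<le> norm (W $ i)"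
          using S'(2) i(1) j(2) by blast
        then show False
          using large[OF j(1)] small[OF i(2)] by simp
      qed
      then have "S' = S"
        using card_seteq[of S S'] S'(1) cS by simp
      then show ?thesis
        using S'(3) by simp
    qed
    ultimately show ?thesis
      by blast
  qed
  then show ?thesis
    using \<open>\<rho> > 0\<close> by blast
qed

text \<open>
  If \<open>rank X < rank Xs\<close>, the norms of the two range projectors, which are the square roots of the ranks,
  differ by at least a fixed amount, and the Lipschitz estimate keeps \<open>X\<close> away from \<open>Xs\<close>.
\<close>

lemma rank_lower_semicontinuous:
  fixes Xs :: "real^'n^'m"
  shows "\<exists>\<rho>>0. \<forall>X. norm (X - Xs) < \<rho> \<longrightarrow> rank Xs \<le> rank X"
proof (cases "rank Xs = 0")
  case True
  then show ?thesis
    by (intro exI[of _ 1]) simp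
next
  case False
  obtain p where p: "range_projector Xs p"
    using range_projector_exists by blast
  obtain c where c: "c \<ge> 0" "\<And>X p'. range_projector X p' \<Longrightarrow> rank X \<le> rank Xs \<Longrightarrow>
      norm (p' - p) \<le> c * norm (X - Xs)"
    using range_projector_lipschitz[OF p] by blast
  \<comment> \<open>The gap between \<open>\<parallel>p\<parallel>\<close> and the largest possible norm of a projector of smaller rank.\<close>
  define g where "g = sqrt (rank Xs) - sqrt (rank Xs - 1)"
  have "g > 0"
    using False by (simp add: g_def)
  have "rank Xs \<le> rank X" if X: "norm (X - Xs) < g / (c + 1)" for X
  proof (rule ccontr)
    assume less: "\<not> rank Xs \<le> rank X"
    obtain p' where p': "range_projector X p'"
      using range_projector_exists by blast
    have "norm p = sqrt (rank Xs)" "norm p' = sqrt (rank X)"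
      using norm_range_projector[OF p] norm_range_projector[OF p'] by (metis norm_ge_zero real_sqrt_unique)+
    \<comment> \<open>The ranks are integers, so \<open>rank X\<close> is at most \<open>rank Xs - 1\<close>.\<close>
    then have "g \<le> norm p - norm p'"
      using less by (simp add: g_def)
    also have "\<dots> \<le> norm (p' - p)"
      by (metis norm_minus_commute norm_triangle_ineq2)
    also have "\<dots> \<le> c * norm (X - Xs)"
      using c(2)[OF p'] less by simp
    also have "\<dots> \<le> (c + 1) * norm (X - Xs)"
      by (simp add: mult_right_mono)
    also have "\<dots> < g"
      using X c(1) by (simp add: field_simps)
    finally show False
      by simp
  qed
  then show ?thesis
    using \<open>g > 0\<close> c(1) by (intro exI[of _ "g / (c + 1)"]) simp
qed

lemma tangent_op_perturbation:
  assumes "projection_matrix d" "projection_matrix p" "projection_matrix q'"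
    and "norm (p' - p) \<le> e" "norm (q' - q) \<le> e"
  shows "norm (tangent_op d p' q' Z - tangent_op d p q Z) \<le> 4 * e * norm Z"
proof -
  have 1: "norm ((p' - p) ** Z) \<le> e * norm Z"
    by (rule order_trans[OF norm_matrix_mult_le]) (simp add: assms mult_right_mono)
  have 2: "norm (d ** Z ** (q' - q)) \<le> e * norm Z"
    using norm_matrix_mult_le[of "d ** Z" "q' - q"] norm_projection_left_le[OF assms(1), of Z]
      mult_mono[OF norm_projection_left_le[OF assms(1), of Z] assms(5)] by (simp add: mult.commute)
  have 3: "norm ((p' - p) ** Z ** q') \<le> e * norm Z"
    using norm_projection_right_le[OF assms(3)] 1 by (rule order_trans)
  have 4: "norm (p ** Z ** (q' - q)) \<le> e * norm Z"
    using norm_matrix_mult_le[of "p ** Z" "q' - q"] norm_projection_left_le[OF assms(2), of Z]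
      mult_mono[OF norm_projection_left_le[OF assms(2), of Z] assms(5)] by (simp add: mult.commute)
  have "tangent_op d p' q' Z - tangent_op d p q Z =
      (p' - p) ** Z + d ** Z ** (q' - q) - (p' - p) ** Z ** q' - p ** Z ** (q' - q)"
    by (simp add: tangent_op_def matrix_diff_left matrix_diff_right)
  also have "norm \<dots> \<le> norm ((p' - p) ** Z) + norm (d ** Z ** (q' - q)) +
      norm ((p' - p) ** Z ** q') + norm (p ** Z ** (q' - q))"
    by (meson add_mono norm_triangle_ineq norm_triangle_ineq4 order_refl order_trans)
  finally show ?thesis
    using 1 2 3 4 by simp
qed

section \<open>One step of the iteration\<close>

lemma spectral_norm_on_range:
  fixes Q :: "'a::euclidean_space \<Rightarrow> 'a"
  assumes Q: "orthogonal_projector Q" and f: "linear f"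
  shows "norm (Q (f (Q Z))) \<le> spectral_norm_on (range Q) f * norm Z"
    and "0 \<le> spectral_norm_on (range Q) f"
proof -
  have "linear Q"
    using Q by (simp add: orthogonal_projector_def)
  then have "bounded_linear (Q \<circ> f \<circ> Q)"
    using f by (simp add: linear_compose linear_conv_bounded_linear[symmetric])
  then show "norm (Q (f (Q Z))) \<le> spectral_norm_on (range Q) f * norm Z"
    "0 \<le> spectral_norm_on (range Q) f"
    using onorm[of "Q \<circ> f \<circ> Q" Z] onorm_pos_le[of "Q \<circ> f \<circ> Q"]
    by (simp_all add: spectral_norm_on_def orth_proj_range[OF Q])
qed

lemma tangent_space_spectral_norm_nonneg:
  fixes Xs :: "real^'n^'m"
  assumes "linear f" and "row_support Xs \<subseteq> S"
  shows "0 \<le> spectral_norm_on (tangent_space (rank_le_rows_in (rank Xs) S) Xs) f"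
proof -
  obtain p q where pq: "range_projectors Xs p q"
    using range_projectors_exist by blast
  have "orthogonal_projector (tangent_op (row_mask S) p q)"
    using assms(2) range_projectors_D[OF pq]
    by (intro orthogonal_projector_tangent_op projection_matrix_row_mask
        range_projectors_rows[OF pq]) (auto simp: row_mask_mult_eq_iff)
  then show ?thesis
    using spectral_norm_on_range(2)[of "tangent_op (row_mask S) p q" f] assms
      tangent_space_eq_range[OF pq refl assms(2)] by simp
qed

lemma linear_id_minus_gram:
  fixes A :: "'a::euclidean_space \<Rightarrow> 'b::euclidean_space"
  assumes "linear A"
  shows "linear (\<lambda>Z. Z - adjoint A (A Z))"
  using assms adjoint_linear[OF assms]
  by (intro linear_compose_sub linear_ident linear_compose[unfolded o_def, of A "adjoint A"])

text \<open>
  With \<open>E = X - Xs\<close> and the tangent projections \<open>Q\<close> at \<open>X\<close> and \<open>Q\<^sub>s\<close> at \<open>Xs\<close>, the new error is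
  \<open>Q\<^sub>s f Q\<^sub>s E + (E - Q E) + (Q - Q\<^sub>s) f E + Q\<^sub>s f (E - Q\<^sub>s E)\<close>.
  The first term is at most \<open>\<delta> \<parallel>E\<parallel>\<close>. The second and the fourth involve normal components, and in the
  third \<open>Q - Q\<^sub>s\<close> is of first order, so these three are of second order.
\<close>

lemma projected_gradient_step_bound:
  fixes Xs :: "real^'n^'m" and f :: "real^'n^'m \<Rightarrow> real^'n^'m"
  assumes f: "linear f" and rk: "rank Xs = k" and S: "row_support Xs \<subseteq> S"
    and \<delta>: "spectral_norm_on (tangent_space (rank_le_rows_in k S) Xs) f = \<delta>"
  shows "\<exists>C\<ge>0. \<forall>X p q. range_projectors X p q \<longrightarrow> rank X \<le> k \<longrightarrow> row_support X \<subseteq> S \<longrightarrow>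
    norm (X - Xs) \<le> 1 \<longrightarrow>
    norm (X - tangent_op (row_mask S) p q ((X - Xs) - f (X - Xs)) - Xs)
      \<le> \<delta> * norm (X - Xs) + C * (norm (X - Xs))\<^sup>2"
proof -
  define d where "d = row_mask S"
  have d: "projection_matrix d"
    by (simp add: d_def projection_matrix_row_mask)
  obtain ps qs where pqs: "range_projectors Xs ps qs"
    using range_projectors_exist by blast
  note pqsD = range_projectors_D[OF pqs]
  obtain c where c: "c \<ge> 0" "\<And>X p' q'. range_projectors X p' q' \<Longrightarrow> rank X \<le> rank Xs \<Longrightarrow>
      norm (p' - ps) \<le> c * norm (X - Xs) \<and> norm (q' - qs) \<le> c * norm (X - Xs)"
    using range_projectors_lipschitz[OF pqs] by blast
  obtain K where K: "K \<ge> 0" "\<And>Z. norm (f Z) \<le> norm Z * K"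
    using bounded_linear.nonneg_bounded linear_conv_bounded_linear f by blast
  have dXs: "d ** Xs = Xs"
    using S by (simp add: d_def row_mask_mult_eq_iff)
  define Qs where "Qs = tangent_op d ps qs"
  have Qs: "orthogonal_projector Qs"
    unfolding Qs_def by (intro orthogonal_projector_tangent_op pqsD d range_projectors_rows[OF pqs dXs])
  have lin_Qs: "linear Qs"
    using Qs by (simp add: orthogonal_projector_def)
  have contr: "norm (Qs (f (Qs Z))) \<le> \<delta> * norm Z" for Z
    using spectral_norm_on_range(1)[OF Qs f, of Z] tangent_space_eq_range[OF pqs rk S] \<delta>
    by (simp add: Qs_def d_def)
  define C where "C = c\<^sup>2 * norm Xs + 4 * c * K + K * (c\<^sup>2 * (norm Xs + 1))"
  have "norm (X - tangent_op d p q ((X - Xs) - f (X - Xs)) - Xs)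
      \<le> \<delta> * norm (X - Xs) + C * (norm (X - Xs))\<^sup>2"
    if pq: "range_projectors X p q" and rkX: "rank X \<le> k" and SX: "row_support X \<subseteq> S"
      and small: "norm (X - Xs) \<le> 1" for X p q
  proof -
    define E where "E = X - Xs"
    define e where "e = norm E"
    define Q where "Q = tangent_op d p q"
    note pqD = range_projectors_D[OF pq]
    have dX: "d ** X = X"
      using SX by (simp add: d_def row_mask_mult_eq_iff)
    have dE: "d ** E = E"
      by (simp add: E_def matrix_diff_right dX dXs)
    have Q: "orthogonal_projector Q"
      unfolding Q_def by (intro orthogonal_projector_tangent_op pqD d range_projectors_rows[OF pq dX])
    have lip: "norm (p - ps) \<le> c * e" "norm (q - qs) \<le> c * e"
      using c(2)[OF pq] rkX rk by (auto simp: e_def E_def)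
    have normX: "norm X \<le> norm Xs + 1"
      using norm_triangle_ineq[of Xs E] small by (simp add: E_def)
    have "E - Q E = - ((d - p) ** Xs ** (mat 1 - q))"
      unfolding Q_def tangent_op_residual[OF dE]
      by (simp add: E_def matrix_diff_right matrix_diff_left pqD dX)
    then have r1: "norm (E - Q E) \<le> c\<^sup>2 * norm Xs * e\<^sup>2"
      using normal_component_bound[OF pqs dXs, of p c e q] lip by (simp add: norm_minus_commute)
    have "E - Qs E = (d - ps) ** X ** (mat 1 - qs)"
      unfolding Qs_def tangent_op_residual[OF dE]
      by (simp add: E_def matrix_diff_right matrix_diff_left pqsD dXs)
    then have "norm (E - Qs E) \<le> c\<^sup>2 * norm X * e\<^sup>2"
      using normal_component_bound[OF pq dX lip] by simp
    also have "\<dots> \<le> c\<^sup>2 * (norm Xs + 1) * e\<^sup>2"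
      using normX by (intro mult_right_mono mult_left_mono) auto
    finally have r2: "norm (E - Qs E) \<le> c\<^sup>2 * (norm Xs + 1) * e\<^sup>2" .
    have "norm (Qs (f (E - Qs E))) \<le> norm (E - Qs E) * K"
      using orthogonal_projector_norm_le[OF Qs] K(2) order_trans by blast
    also have "\<dots> \<le> (c\<^sup>2 * (norm Xs + 1) * e\<^sup>2) * K"
      using r2 K(1) by (rule mult_right_mono)
    finally have r3: "norm (Qs (f (E - Qs E))) \<le> K * (c\<^sup>2 * (norm Xs + 1)) * e\<^sup>2"
      by (simp add: mult.commute mult.left_commute)
    have "norm (Q (f E) - Qs (f E)) \<le> 4 * (c * e) * norm (f E)"
      unfolding Q_def Qs_def by (intro tangent_op_perturbation d pqsD pqD lip)
    also have "\<dots> \<le> 4 * (c * e) * (e * K)"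
      using K(2)[of E] c(1) by (intro mult_left_mono) (auto simp: e_def)
    finally have r4: "norm (Q (f E) - Qs (f E)) \<le> 4 * c * K * e\<^sup>2"
      by (simp add: power2_eq_square ac_simps)
    have "X - Q (E - f E) - Xs = (E - Q E) + (Q (f E) - Qs (f E)) + Qs (f (E - Qs E)) + Qs (f (Qs E))"
      using Q lin_Qs f by (simp add: orthogonal_projector_def linear_diff E_def)
    also have "norm \<dots> \<le> norm (E - Q E) + norm (Q (f E) - Qs (f E)) + norm (Qs (f (E - Qs E)))
        + norm (Qs (f (Qs E)))"
      by (meson add_mono norm_triangle_ineq order_refl order_trans)
    also have "\<dots> \<le> c\<^sup>2 * norm Xs * e\<^sup>2 + 4 * c * K * e\<^sup>2 + K * (c\<^sup>2 * (norm Xs + 1)) * e\<^sup>2 + \<delta> * e"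
      using r1 r4 r3 contr[of E] unfolding e_def by (intro add_mono)
    also have "\<dots> = \<delta> * e + C * e\<^sup>2"
      by (simp add: C_def algebra_simps)
    finally show ?thesis
      unfolding E_def e_def Q_def .
  qed
  moreover have "C \<ge> 0"
    using c(1) K(1) by (simp add: C_def)
  ultimately show ?thesis
    unfolding d_def by blast
qed

lemma threshold_rank_approx_sparse:
  assumes "is_row_threshold s W Z" "is_best_rank_approx k Z V"
  shows "rank V \<le> k" "card (row_support V) \<le> s"
proof -
  show "rank V \<le> k"
    using assms(2) by (simp add: is_best_rank_approx_def is_metric_proj_def rank_le_def)
  obtain S where S: "card S = s" "Z = restrict_rows S W"
    using assms(1) by (auto simp: is_row_threshold_def)
  have "row_mask S ** Z = Z"
    unfolding restrict_rows_eq_row_mask[symmetric] S(2) by (simp add: restrict_rows_def vec_eq_iff)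
  then have "row_mask S ** V = V"
    by (rule best_rank_approx_rows[OF assms(2) projection_matrix_row_mask])
  then show "card (row_support V) \<le> s"
    unfolding row_mask_mult_eq_iff using card_mono[of S "row_support V"] S(1) by simp
qed

text \<open>
  The second range projector belongs to \<open>transpose X\<close>, whose singular value decomposition arises by
  exchanging the two families of singular vectors.
\<close>

lemma tangent_proj_full_rank:
  assumes "is_tangent_proj k X P" "rank X = k"
  shows "\<exists>p q. range_projectors X p q \<and> P = tangent_op (mat 1) p q"
proof -
  obtain u \<sigma> v where svd: "thin_svd k X u \<sigma> v"
    and P: "\<And>Z. P Z = gram k u ** Z + Z ** gram k v - gram k u ** Z ** gram k v"
    using assms by (auto simp: is_tangent_proj_def)
  have "range_projectors X (gram k u) (gram k v)"
    unfolding range_projectors_def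
    using thin_svd_range_projector[OF svd] thin_svd_range_projector[OF thin_svd_transpose[OF svd]] by simp
  moreover have "P = tangent_op (mat 1) (gram k u) (gram k v)"
    by (rule ext) (simp add: P tangent_op_def matrix_diff_left)
  ultimately show ?thesis
    by blast
qed

lemma row_mask_tangent_op:
  "d ** p = p \<Longrightarrow> d ** tangent_op (mat 1) p q Z = tangent_op d p q Z"
  by (simp add: tangent_op_def matrix_add_right matrix_diff_left matrix_diff_right matrix_mul_assoc)

text \<open>
  Near \<open>Xs\<close> the iterate has rank \<open>k\<close> and row support \<open>S\<close>, so the tangent projection is given by the
  explicit formula and thresholding after the gradient step restricts to the rows in \<open>S\<close>. This
  restriction turns the rank-\<open>k\<close> tangent projection into the one onto the smaller tangent space at \<open>X\<close>,
  which differs to first order from the one at \<open>Xs\<close> on which \<open>\<delta>\<close> bounds \<open>I - A\<^sup>* A\<close>. The low-rank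
  approximation then adds only a second-order term.
\<close>

lemma riht_step_contraction:
  fixes A :: "real^'n^'m \<Rightarrow> real^'l" and H T :: "real^'n^'m \<Rightarrow> real^'n^'m"
  assumes A: "linear A"
    and H: "\<And>X. is_row_threshold s X (H X)" and T: "\<And>X. is_best_rank_approx k X (T X)"
    and rk: "rank Xs = k" and S: "S = row_support Xs" and cS: "card S = s"
    and \<delta>: "spectral_norm_on (tangent_space (rank_le_rows_in k S) Xs) (\<lambda>Z. Z - adjoint A (A Z)) = \<delta>"
    and "\<delta> < 1"
  shows "\<exists>\<eta>>0. \<exists>C\<ge>0. \<forall>X P. rank X \<le> k \<longrightarrow> card (row_support X) \<le> s \<longrightarrow> is_tangent_proj k X P \<longrightarrow>
    norm (X - Xs) \<le> \<eta> \<longrightarrow>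
    norm (T (H (X - P (adjoint A (A X - A Xs)))) - Xs) \<le> \<delta> * norm (X - Xs) + C * (norm (X - Xs))\<^sup>2"
proof -
  define f where "f Z = Z - adjoint A (A Z)" for Z
  have lin_f: "linear f"
    unfolding f_def by (rule linear_id_minus_gram[OF A])
  obtain K where K: "K \<ge> 0" "\<And>Z. norm (f Z) \<le> norm Z * K"
    using bounded_linear.nonneg_bounded linear_conv_bounded_linear lin_f by blast
  obtain C1 where C1: "C1 \<ge> 0" "\<And>X p q. range_projectors X p q \<Longrightarrow> rank X \<le> k \<Longrightarrow> row_support X \<subseteq> S \<Longrightarrow>
      norm (X - Xs) \<le> 1 \<Longrightarrow> norm (X - tangent_op (row_mask S) p q ((X - Xs) - f (X - Xs)) - Xs)
        \<le> \<delta> * norm (X - Xs) + C1 * (norm (X - Xs))\<^sup>2"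
    using projected_gradient_step_bound[OF lin_f rk, of S \<delta>] S \<delta> unfolding f_def by blast
  obtain C2 where C2: "C2 \<ge> 0" "\<And>Y Z. is_best_rank_approx k Y Z \<Longrightarrow>
      norm (Z - Xs) \<le> norm (Y - Xs) + C2 * (norm (Y - Xs))\<^sup>2"
    using best_rank_approx_almost_nonexpansive[of Xs] rk by blast
  obtain \<rho>1 where \<rho>1: "\<rho>1 > 0" "\<And>W. norm (W - Xs) < \<rho>1 \<Longrightarrow> card (row_support W) \<le> s \<Longrightarrow> row_support W = S"
      "\<And>W Z. norm (W - Xs) < \<rho>1 \<Longrightarrow> is_row_threshold s W Z \<Longrightarrow> Z = restrict_rows S W"
    using restrict_rows_threshold_near[OF S cS] by blast
  obtain \<rho>2 where \<rho>2: "\<rho>2 > 0" "\<And>X. norm (X - Xs) < \<rho>2 \<Longrightarrow> rank Xs \<le> rank X"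
    using rank_lower_semicontinuous[of Xs] by blast
  \<comment> \<open>The gradient step leads at most \<open>(K + 2) \<parallel>X - Xs\<parallel>\<close> away from \<open>Xs\<close>, within the stability radius \<open>\<rho>1\<close>.\<close>
  define \<eta> where "\<eta> = min 1 (min (\<rho>1 / (2 * (K + 2))) (\<rho>2 / 2))"
  have \<eta>: "\<eta> > 0" "\<eta> \<le> 1" "(K + 2) * \<eta> < \<rho>1" "\<eta> < \<rho>2"
  proof -
    show "\<eta> > 0" "\<eta> \<le> 1"
      using \<rho>1(1) \<rho>2(1) K(1) by (auto simp: \<eta>_def)
    have "\<eta> \<le> \<rho>2 / 2"
      unfolding \<eta>_def by linarith
    then show "\<eta> < \<rho>2"
      using \<rho>2(1) by simp
    have "(K + 2) * \<eta> \<le> (K + 2) * (\<rho>1 / (2 * (K + 2)))"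
      using K(1) by (intro mult_left_mono) (auto simp: \<eta>_def)
    also have "\<dots> = \<rho>1 / 2"
      using K(1) by (simp add: field_simps)
    also have "\<dots> < \<rho>1"
      using \<rho>1(1) by simp
    finally show "(K + 2) * \<eta> < \<rho>1" .
  qed
  define C where "C = C1 + C2 * (1 + C1)\<^sup>2"
  have "norm (T (H (X - P (adjoint A (A X - A Xs)))) - Xs) \<le> \<delta> * norm (X - Xs) + C * (norm (X - Xs))\<^sup>2"
    if rkX: "rank X \<le> k" and sX: "card (row_support X) \<le> s" and P: "is_tangent_proj k X P"
      and small: "norm (X - Xs) \<le> \<eta>" for X P
  proof -
    define e where "e = norm (X - Xs)"
    define G where "G = (X - Xs) - f (X - Xs)"
    have G: "adjoint A (A X - A Xs) = G"
      using A by (simp add: G_def f_def linear_diff)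
    have e: "0 \<le> e" "e \<le> 1" "e < \<rho>2"
      using small \<eta> by (auto simp: e_def)
    have "rank X = k"
      using \<rho>2(2)[of X] e rkX rk by (simp add: e_def)
    then obtain p q where pq: "range_projectors X p q" and P_eq: "P = tangent_op (mat 1) p q"
      using tangent_proj_full_rank[OF P] by blast
    note pqD = range_projectors_D[OF pq]
    have "norm G \<le> norm (X - Xs) + norm (f (X - Xs))"
      unfolding G_def by (rule norm_triangle_ineq4)
    then have "norm G \<le> (K + 1) * e"
      using K(2)[of "X - Xs"] by (simp add: e_def algebra_simps)
    moreover have "norm (P G) \<le> norm G"
      unfolding P_eq by (intro orthogonal_projector_norm_le orthogonal_projector_tangent_op pqD
          projection_matrix_mat_1) simp
    moreover have "norm (X - P G - Xs) \<le> norm (X - Xs) + norm (P G)"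
      using norm_triangle_ineq4[of "X - Xs" "P G"] by (simp add: algebra_simps)
    ultimately have W: "norm (X - P G - Xs) \<le> (K + 2) * e"
      by (simp add: e_def algebra_simps)
    also have "\<dots> \<le> (K + 2) * \<eta>"
      using K(1) small by (intro mult_left_mono) (auto simp: e_def)
    finally have "norm (X - P G - Xs) < \<rho>1"
      using \<eta>(3) by simp
    then have HW: "H (X - P G) = restrict_rows S (X - P G)"
      using \<rho>1(3) H by blast
    have "e \<le> (K + 2) * e"
      using K(1) e(1) by (simp add: algebra_simps)
    also have "\<dots> \<le> (K + 2) * \<eta>"
      using K(1) small by (intro mult_left_mono) (auto simp: e_def)
    finally have SX: "row_support X = S"
      using \<rho>1(2)[of X] sX \<eta>(3) by (simp add: e_def)
    then have dX: "row_mask S ** X = X"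
      by (simp add: row_mask_mult_eq_iff)
    have "H (X - P G) = X - tangent_op (row_mask S) p q G"
      unfolding HW unfolding restrict_rows_eq_row_mask P_eq
      by (simp add: matrix_diff_right dX row_mask_tangent_op range_projectors_rows[OF pq dX])
    then have F: "norm (H (X - P G) - Xs) \<le> \<delta> * e + C1 * e\<^sup>2"
      using C1(2)[OF pq rkX] SX e(2) by (simp add: G_def e_def)
    also have "\<dots> \<le> 1 * e + C1 * e"
      using \<open>\<delta> < 1\<close> e C1(1)
      by (intro add_mono mult_mono mult_left_mono) (auto simp: power2_eq_square mult_left_le)
    finally have F': "norm (H (X - P G) - Xs) \<le> (1 + C1) * e"
      by (simp add: algebra_simps)
    have "norm (T (H (X - P G)) - Xs) \<le> norm (H (X - P G) - Xs) + C2 * (norm (H (X - P G) - Xs))\<^sup>2"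
      by (rule C2(2)[OF T])
    also have "\<dots> \<le> (\<delta> * e + C1 * e\<^sup>2) + C2 * ((1 + C1) * e)\<^sup>2"
      using F F' C2(1) by (intro add_mono mult_left_mono power_mono) auto
    also have "\<dots> = \<delta> * e + C * e\<^sup>2"
      unfolding C_def power_mult_distrib by (simp add: algebra_simps del: power_mult_distrib)
    finally show ?thesis
      by (simp add: G e_def)
  qed
  moreover have "C \<ge> 0"
    using C1(1) C2(1) by (simp add: C_def)
  ultimately show ?thesis
    using \<eta>(1) by blast
qed

section \<open>Convergence\<close>

text \<open>
  Once the error is so small that the quadratic term uses up at most half of the gap \<open>1 - \<delta>\<close>, every
  further step contracts by the factor \<open>(1 + \<delta>) / 2\<close>. Since the error tends to zero, the quadratic term
  becomes negligible and the rate improves to \<open>\<delta>\<close>.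
\<close>

lemma eventual_linear_convergence:
  fixes e :: "nat \<Rightarrow> real"
  assumes nn: "\<And>n. 0 \<le> e n" and \<delta>: "0 \<le> \<delta>" "\<delta> < 1" and C: "0 \<le> C"
    and step: "\<And>n. l0 \<le> n \<Longrightarrow> e n \<le> \<eta> \<Longrightarrow> e (Suc n) \<le> \<delta> * e n + C * (e n)\<^sup>2"
    and start: "e l0 \<le> \<epsilon>" and \<epsilon>: "\<epsilon> \<le> \<eta>" "C * \<epsilon> \<le> (1 - \<delta>) / 2"
  shows "e \<longlonglongrightarrow> 0" "limsup (\<lambda>n. ereal (e (Suc n) / e n)) \<le> ereal \<delta>"
proof -
  define a where "a = (1 + \<delta>) / 2"
  have a: "0 \<le> a" "a < 1"
    using \<delta> by (auto simp: a_def)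
  have contr: "e (Suc n) \<le> a * e n" if "l0 \<le> n" "e n \<le> \<epsilon>" for n
  proof -
    have "e (Suc n) \<le> \<delta> * e n + C * (e n)\<^sup>2"
      using step that \<epsilon>(1) by simp
    also have "C * (e n)\<^sup>2 = (C * e n) * e n"
      by (simp add: power2_eq_square)
    also have "\<dots> \<le> (C * \<epsilon>) * e n"
      using that nn C by (intro mult_right_mono mult_left_mono) auto
    also have "\<dots> \<le> ((1 - \<delta>) / 2) * e n"
      using \<epsilon>(2) nn by (rule mult_right_mono)
    finally show ?thesis
      by (simp add: a_def algebra_simps) (simp add: field_simps)
  qed
  have geo: "e (n + l0) \<le> a ^ n * e l0 \<and> e (n + l0) \<le> \<epsilon>" for n
  proof (induction n)
    case 0
    then show ?case
      using start by simp
  next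
    case (Suc n)
    have "e (Suc (n + l0)) \<le> a * e (n + l0)"
      using Suc by (intro contr) auto
    also have "\<dots> \<le> a * (a ^ n * e l0)"
      using Suc a(1) by (intro mult_left_mono) auto
    finally have 1: "e (Suc (n + l0)) \<le> a * (a ^ n * e l0)" .
    have "a * e (n + l0) \<le> 1 * e (n + l0)"
      using a nn by (intro mult_right_mono) auto
    then have "e (Suc (n + l0)) \<le> \<epsilon>"
      using Suc \<open>e (Suc (n + l0)) \<le> a * e (n + l0)\<close> by simp
    with 1 show ?case
      by (simp add: mult.assoc)
  qed
  have "(\<lambda>n. a ^ n * e l0) \<longlonglongrightarrow> 0"
    using a by (intro tendsto_mult_left_zero LIMSEQ_realpow_zero) auto
  then have "(\<lambda>n. e (n + l0)) \<longlonglongrightarrow> 0"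
    by (rule tendsto_sandwich[OF _ _ tendsto_const, rotated 2]) (use nn geo in auto)
  then show lim: "e \<longlonglongrightarrow> 0"
    by (rule LIMSEQ_offset)
  have "e (Suc n) / e n \<le> \<delta> + C * e n" if "l0 \<le> n" for n
  proof (cases "e n = 0")
    case True
    then show ?thesis
      using \<delta> by simp
  next
    case False
    then have "e n > 0"
      using nn[of n] by simp
    have "e n \<le> \<eta>"
      using geo[of "n - l0"] that \<epsilon>(1) by simp
    then have "e (Suc n) \<le> (\<delta> + C * e n) * e n"
      using step[OF that] by (simp add: power2_eq_square algebra_simps)
    then show ?thesis
      using \<open>e n > 0\<close> by (simp add: pos_divide_le_eq)
  qed
  then have "limsup (\<lambda>n. ereal (e (Suc n) / e n)) \<le> limsup (\<lambda>n. ereal (\<delta> + C * e n))"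
    by (intro Limsup_mono eventually_sequentiallyI[of l0]) simp
  also have "limsup (\<lambda>n. ereal (\<delta> + C * e n)) = ereal \<delta>"
  proof (rule lim_imp_Limsup[OF trivial_limit_sequentially])
    have "(\<lambda>n. \<delta> + C * e n) \<longlonglongrightarrow> \<delta> + C * 0"
      by (intro tendsto_intros lim)
    then show "(\<lambda>n. ereal (\<delta> + C * e n)) \<longlonglongrightarrow> ereal \<delta>"
      by (intro tendsto_ereal) simp
  qed
  finally show "limsup (\<lambda>n. ereal (e (Suc n) / e n)) \<le> ereal \<delta>" .
qed

lemma riemannian_iht_iterate_sparse:
  assumes "riemannian_iht k A y H T \<alpha> P X" "l \<ge> 1"
    and "\<And>X. is_row_threshold s X (H X)" "\<And>X. is_best_rank_approx k X (T X)"
  shows "rank (X l) \<le> k" "card (row_support (X l)) \<le> s"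
proof -
  have "\<exists>W. X l = T (H W)"
  proof (cases "l = 1")
    case True
    then show ?thesis
      using assms(1) by (auto simp: riemannian_iht_def)
  next
    case False
    then have "l = Suc (l - 1)" "l - 1 \<ge> 1"
      using assms(2) by auto
    then show ?thesis
      using assms(1) unfolding riemannian_iht_def by (metis comp_apply)
  qed
  then show "rank (X l) \<le> k" "card (row_support (X l)) \<le> s"
    using threshold_rank_approx_sparse[OF assms(3,4)] by auto
qed

theorem proposition3p3:
  fixes A :: "real^'N^'M \<Rightarrow> real^'m" and y :: "real^'m"
    and k s :: nat
    and H T :: "real^'N^'M \<Rightarrow> real^'N^'M"
    and Xs :: "real^'N^'M" and Ss :: "'M set" and \<delta> :: real
  assumes "linear A"
    and "0 < k" and "k < s"
    and "\<And>X. is_row_threshold s X (H X)"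
    and "\<And>X. is_best_rank_approx k X (T X)"
    and "A Xs = y" and "Xs \<in> rank_row_sparse k s"
    and "rank Xs = min k s"
    and "Ss = row_support Xs" and "card Ss = s"
    and "spectral_norm_on (tangent_space (rank_le_rows_in k Ss) Xs) (\<lambda>Z. Z - adjoint A (A Z)) = \<delta>"
    and "\<delta> < 1"
  shows "\<exists>\<epsilon>>0. \<forall>\<alpha>\<^sub>0 P X.
    riemannian_iht k A y H T \<alpha>\<^sub>0 P X \<longrightarrow>
    (\<exists>l\<ge>1. norm (X l - Xs) \<le> \<epsilon>) \<longrightarrow>
      X \<longlonglongrightarrow> Xs \<and>
      limsup (\<lambda>l. ereal (norm (X (Suc l) - Xs) / norm (X l - Xs))) \<le> ereal \<delta>"
proof -
  have rk: "rank Xs = k"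
    using assms(3,8) by simp
  obtain \<eta> C where \<eta>: "\<eta> > 0" and C: "C \<ge> 0"
    and step: "\<And>X P. rank X \<le> k \<Longrightarrow> card (row_support X) \<le> s \<Longrightarrow> is_tangent_proj k X P \<Longrightarrow>
      norm (X - Xs) \<le> \<eta> \<Longrightarrow> norm (T (H (X - P (adjoint A (A X - y)))) - Xs)
        \<le> \<delta> * norm (X - Xs) + C * (norm (X - Xs))\<^sup>2"
    using riht_step_contraction[OF assms(1,4,5) rk assms(9,10,11,12)] assms(6) by auto
  have "\<delta> \<ge> 0"
    using tangent_space_spectral_norm_nonneg[OF linear_id_minus_gram[OF assms(1)], of Xs Ss]
      assms(9,11) rk by simp
  define \<epsilon> where "\<epsilon> = min \<eta> ((1 - \<delta>) / (2 * (C + 1)))"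
  have \<epsilon>: "\<epsilon> > 0" "\<epsilon> \<le> \<eta>"
    using \<eta> C assms(12) by (auto simp: \<epsilon>_def)
  have "C * \<epsilon> \<le> (C + 1) * ((1 - \<delta>) / (2 * (C + 1)))"
    using C \<epsilon>(1) by (intro mult_mono) (auto simp: \<epsilon>_def)
  also have "\<dots> = (1 - \<delta>) / 2"
    using C by (simp add: field_simps)
  finally have C\<epsilon>: "C * \<epsilon> \<le> (1 - \<delta>) / 2" .
  have "X \<longlonglongrightarrow> Xs \<and> limsup (\<lambda>l. ereal (norm (X (Suc l) - Xs) / norm (X l - Xs))) \<le> ereal \<delta>"
    if iht: "riemannian_iht k A y H T \<alpha> P X" and l0: "l0 \<ge> 1" "norm (X l0 - Xs) \<le> \<epsilon>" for \<alpha> P X l0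
  proof -
    have "norm (X (Suc l) - Xs) \<le> \<delta> * norm (X l - Xs) + C * (norm (X l - Xs))\<^sup>2"
      if "l0 \<le> l" "norm (X l - Xs) \<le> \<eta>" for l
    proof -
      have "l \<ge> 1"
        using that l0 by simp
      moreover have "is_tangent_proj k (X l) (P l)"
          "X (Suc l) = T (H (X l - P l (adjoint A (A (X l) - y))))"
        using iht \<open>l \<ge> 1\<close> by (auto simp: riemannian_iht_def)
      ultimately show ?thesis
        using step[of "X l" "P l"] that riemannian_iht_iterate_sparse[OF iht _ assms(4,5)] by simp
    qed
    note conv = eventual_linear_convergence[where e = "\<lambda>l. norm (X l - Xs)",
        OF norm_ge_zero \<open>\<delta> \<ge> 0\<close> assms(12) C this l0(2) \<epsilon>(2) C\<epsilon>]
    have "X \<longlonglongrightarrow> Xs"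
      using conv(1) by (simp add: tendsto_norm_zero_iff LIM_zero_iff)
    with conv(2) show ?thesis
      by blast
  qed
  then show ?thesis
    using \<epsilon>(1) by blast
qed

end
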